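(* Let $\alpha\in[0,1)$ and $L\in\mathcal R_0$. Let $\sigma$ be a finite positive Borel measure on $[0,+\infty]$, let $\gamma\in\mathbb R$, and let $v:(-1,0)\to\mathbb R$ be given by $$v\left(\frac{z}{1-z}\right)=\gamma+\int_{[0,+\infty]}\frac{1+tz}{z-t}\,\sigma(\mathrm dt),\qquad z<0 .$$ The following two conditions are equivalent: $$\sigma\big([0,x)\big)\sim x^{\alpha}L(1/x)\quad\text{as }x\to0^+,$$ $$v(-1/x)\sim-\frac{\pi\alpha}{\sin(\pi\alpha)}\,x^{1-\alpha}L(x)\quad\text{as }x\to+\infty .$$ Each of these equivalent conditions implies that for all $\gamma\in\mathbb R$, as $x\to+\infty$, $$\mu_\boxtimes^{\gamma,\sigma}\big((x,+\infty)\big)\sim\left(\frac{\pi\alpha}{\sin(\pi\alpha)}\right)^{1/(1-\alpha)}\frac{1}{(\log x)^{1/(1-\alpha)}\,L_\alpha^{\#}\big((\log x)^{1/(1-\alpha)}\big)},$$ where $L_\alpha:=L^{1/(1-\alpha)}\in\mathcal R_0$ and $L_\alpha^{\#}$ is its de Bruijn conjugate. (For $\alpha=0$ the factor $\pi\alpha/\sin(\pi\alpha)$ is read as $1$.)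
   Context: $f\sim g$ means that $f/g\to1$ in the indicated limit. $\mathcal R_0$ is the class of slowly varying functions: (positive, measurable) $f$ on a neighborhood of $+\infty$ with $f(\lambda x)/f(x)\to1$ as $x\to+\infty$ for every $\lambda>0$. A de Bruijn conjugate of $\ell\in\mathcal R_0$ is a slowly varying function $\ell^{\#}$, unique up to asymptotic equivalence, with $\ell(x)\ell^{\#}(x\ell(x))\to1$ and $\ell^{\#}(x)\ell(x\ell^{\#}(x))\to1$ as $x\to+\infty$. In the integral defining $v$, the integrand equals $1/z$ at $t=0$ and $-z$ at $t=+\infty$. For a Borel probability measure $\mu\ne\delta_0$ on $[0,+\infty)$ put $\delta=\mu(\{0\})$ and $\psi_\mu(z)=\int_{[0,+\infty)}\frac{zt}{1-zt}\,\mu(\mathrm dt)$, $z<0$; $\psi_\mu:(-\infty,0)\to(\delta-1,0)$ is invertible with inverse $\chi_\mu$ and the $S$-transform is $S_\mu(z)=\frac{z+1}{z}\chi_\mu(z)$, $z\in(\delta-1,0)$. It determines $\mu$ uniquely. $\mu_\boxtimes^{\gamma,\sigma}$ denotes the probability measure on $[0,+\infty)$ with $S$-transform $S(z)=\exp(v(z))$, $z\in(-1,0)$, where $v$ is determined by $\gamma,\sigma$ via the formula in the claim. By a theorem of Bercovici and Voiculescu such a measure exists for each pair $(\gamma,\sigma)$, and these are exactly the measures infinitely divisible with respect to free multiplicative convolution $\boxtimes$. *)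

theory Defs
  imports "HOL-Probability.Probability" "HOL-Library.Landau_Symbols"
begin

text \<open>
  Measurability is Lebesgue measurability, as is usual for regular variation; positivity and
  measurability are required on a neighbourhood of infinity only.
\<close>

definition slowly_varying :: "(real \<Rightarrow> real) \<Rightarrow> bool" where
  "slowly_varying f \<longleftrightarrow>
     (\<exists>a. (\<forall>x>a. 0 < f x) \<and> f \<in> borel_measurable (lebesgue_on {a<..})) \<and>
     (\<forall>c>0. ((\<lambda>x. f (c * x) / f x) \<longlongrightarrow> 1) at_top)"

definition de_Bruijn_conjugate :: "(real \<Rightarrow> real) \<Rightarrow> (real \<Rightarrow> real) \<Rightarrow> bool" where
  "de_Bruijn_conjugate l l' \<longleftrightarrow>
     slowly_varying l' \<and>
     ((\<lambda>x. l x * l' (x * l x)) \<longlongrightarrow> 1) at_top \<and>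
     ((\<lambda>x. l' x * l (x * l' x)) \<longlongrightarrow> 1) at_top"

definition prob_on_nonneg :: "real measure \<Rightarrow> bool" where
  "prob_on_nonneg \<mu> \<longleftrightarrow> prob_space \<mu> \<and> sets \<mu> = sets borel \<and> emeasure \<mu> {..<0} = 0"

definition psi :: "real measure \<Rightarrow> real \<Rightarrow> real" where
  "psi \<mu> z = (LINT t:{0..}|\<mu>. z * t / (1 - z * t))"

definition chi :: "real measure \<Rightarrow> real \<Rightarrow> real" where
  "chi \<mu> = the_inv_into {..<0} (psi \<mu>)"

text \<open>
  The next two definitions are meaningful for a probability measure on the nonnegative
  half-line other than the point mass at \<open>0\<close>; outside \<open>S_domain \<mu>\<close> the value
  of \<open>S_transform \<mu>\<close> carries no meaning.
\<close>

definition S_domain :: "real measure \<Rightarrow> real set" where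
  "S_domain \<mu> = {measure \<mu> {0} - 1<..<0}"

definition S_transform :: "real measure \<Rightarrow> real \<Rightarrow> real" where
  "S_transform \<mu> z = (z + 1) / z * chi \<mu> z"

text \<open>
  The compact half-line \<open>[0,\<infinity>]\<close> is the type \<^typ>\<open>ennreal\<close>; at
  \<open>t = \<infinity>\<close> the kernel takes its limit value.
\<close>

definition levy_kernel :: "real \<Rightarrow> ennreal \<Rightarrow> real" where
  "levy_kernel z t =
     (if t = \<infinity> then - z else (1 + enn2real t * z) / (z - enn2real t))"

text \<open>
  As \<open>z\<close> runs through the negative reals, \<open>z / (1 - z)\<close> runs exactly once
  through \<open>(-1,0)\<close>, so this determines \<open>v\<close> on that interval and says nothing
  about \<open>v\<close> elsewhere.
\<close>

definition levy_exponent :: "real \<Rightarrow> ennreal measure \<Rightarrow> (real \<Rightarrow> real) \<Rightarrow> bool" where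
  "levy_exponent \<gamma> \<sigma> v \<longleftrightarrow>
     (\<forall>z<0. v (z / (1 - z)) = \<gamma> + (LINT t|\<sigma>. levy_kernel z t))"

text \<open>
  \<open>\<mu>\<close> is the freely multiplicatively infinitely divisible law with parameters
  \<open>\<gamma>, \<sigma>\<close>. A function and its domain are compared, so an atom at \<open>0\<close> is
  excluded by the second conjunct. The measure exists by a theorem of
  Bercovici and Voiculescu and is determined by its S-transform.
\<close>

definition free_mult_id_law :: "real \<Rightarrow> ennreal measure \<Rightarrow> real measure \<Rightarrow> bool" where
  "free_mult_id_law \<gamma> \<sigma> \<mu> \<longleftrightarrow>
     prob_on_nonneg \<mu> \<and> S_domain \<mu> = {-1<..<0} \<and>
     (\<exists>v. levy_exponent \<gamma> \<sigma> v \<and> (\<forall>z\<in>{-1<..<0}. S_transform \<mu> z = exp (v z)))"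

definition stieltjes_const :: "real \<Rightarrow> real" where
  "stieltjes_const \<alpha> = (if \<alpha> = 0 then 1 else pi * \<alpha> / sin (pi * \<alpha>))"

end

theory Submission
  imports Defs "HOL-Real_Asymp.Real_Asymp"
begin

text \<open>
  The first equivalence is a Karamata theorem for Stieltjes transforms. After a change of variable
  the exponent \<open>v\<close> is, up to a bounded term and a factor that tends to 1, minus the Stieltjes
  transform of \<open>\<sigma>\<close> near 0, and \<open>x powr (1 - \<alpha>) * L x\<close> diverges, so the bounded
  term is irrelevant. The Abelian
  half, lemma \<open>stieltjes_abelian\<close>, writes the transform as an integral of masses of initial
  intervals and passes to the limit by dominated convergence. For the Tauberian half,
  \<open>stieltjes_tauberian\<close>, the rescaled measure is encoded as a probability law on the unit interval,
  on which the ratios of the transform at different scales become the integrals of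
  \<open>1 / (1 - q x)\<close>. These determine the moments, hence the weak limit, which is a
  generalized arcsine law; integrating one further test function against it returns the mass of
  the initial interval.

  For the tail of a law \<open>\<mu>\<close> put \<open>U y = - psi \<mu> (- 1 / y)\<close>. The definition of the S-transform then
  reads \<open>y = (x - 1) * exp (- v (- 1 / x))\<close> with \<open>x = 1 / U y\<close>, so \<open>ln y\<close> is equivalent to
  \<open>C * x powr (1 - \<alpha>) * L x\<close>, where \<open>C\<close> is \<open>stieltjes_const \<alpha>\<close>. Solving for \<open>x\<close> is
  exactly what the de Bruijn conjugate does (\<open>inverse_asymp_de_Bruijn\<close>), which yields the claimed
  asymptotics for \<open>U\<close> itself. Since they are regularly varying in \<open>ln y\<close>, replacing \<open>y\<close> by \<open>y powr (1 \<plusminus> e)\<close> changes \<open>U\<close> by a factor close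
  to 1, and \<open>\<mu> (y, \<infinity>)\<close> is squeezed between these values (\<open>tail_equiv_tail_transform\<close>).

  The functions \<open>L\<close> and \<open>L'\<close> are merely measurable. What makes equivalent arguments
  interchangeable inside them is the uniform convergence theorem for slowly varying functions,
  used in the form \<open>slowly_varying_compose_equiv\<close>.
\<close>

section \<open>Slowly varying functions\<close>

lemma slowly_varying_eventually_pos:
  "slowly_varying f \<Longrightarrow> \<forall>\<^sub>F x in at_top. 0 < f x"
  unfolding slowly_varying_def by (meson eventually_gt_at_top eventually_mono)

lemma slowly_varying_scale:
  "slowly_varying f \<Longrightarrow> 0 < c \<Longrightarrow> ((\<lambda>x. f (c * x) / f x) \<longlongrightarrow> 1) at_top"
  unfolding slowly_varying_def by blast

lemma slowly_varying_powr:
  assumes "slowly_varying f"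
  shows "slowly_varying (\<lambda>x. f x powr p)"
proof -
  obtain a where a: "\<And>x. x > a \<Longrightarrow> 0 < f x" and
    m[measurable]: "f \<in> borel_measurable (lebesgue_on {a<..})"
    using assms unfolding slowly_varying_def by blast
  have "((\<lambda>x. f (c * x) powr p / f x powr p) \<longlongrightarrow> 1) at_top" if "c > 0" for c
  proof -
    have "((\<lambda>x. (f (c * x) / f x) powr p) \<longlongrightarrow> 1 powr p) at_top"
      by (intro tendsto_intros slowly_varying_scale assms that) auto
    moreover have "\<forall>\<^sub>F x in at_top. (f (c * x) / f x) powr p = f (c * x) powr p / f x powr p"
      using eventually_gt_at_top[of a] eventually_gt_at_top[of "a / c"]
    proof eventually_elim
      case (elim x)
      then show ?case using a[of x] a[of "c * x"] that by (simp add: powr_divide field_simps)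
    qed
    ultimately show ?thesis by (simp add: filterlim_cong)
  qed
  moreover have "(\<lambda>x. f x powr p) \<in> borel_measurable (lebesgue_on {a<..})" by measurable
  moreover have "f x powr p > 0" if "x > a" for x using a[OF that] by simp
  ultimately show ?thesis unfolding slowly_varying_def by blast
qed

text \<open>
  Pointwise convergence of \<open>h (c * u k) - h (u k)\<close> in \<open>c\<close> means that the increasing
  sets \<open>A n\<close> exhaust the interval of dilation factors, so their measures converge to its length.
\<close>

lemma measure_close_dilates:
  fixes h :: "real \<Rightarrow> real"
  assumes hm: "h \<in> borel_measurable lebesgue"
    and h: "\<And>c. c > 0 \<Longrightarrow> ((\<lambda>x. h (c * x) - h x) \<longlongrightarrow> 0) at_top"
    and u: "filterlim u at_top sequentially" and e: "e > 0"
  defines "A \<equiv> (\<lambda>n. {c\<in>{1..2}. \<forall>k\<ge>n. \<bar>h (c * u k) - h (u k)\<bar> < e})"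
  shows "A n \<in> sets lebesgue" and "(\<lambda>n. measure lebesgue (A n)) \<longlonglongrightarrow> 1"
proof -
  define H where "H = (\<lambda>k c. h (c * u k))"
  have H[measurable]: "H k \<in> borel_measurable lebesgue" for k
    using measurable_compose[OF lebesgue_measurable_scaling[of "u k"] hm]
    by (simp add: mult.commute H_def)
  have eq: "A n = {1..2} \<inter> {c\<in>space lebesgue. \<forall>k\<ge>n. \<bar>H k c - h (u k)\<bar> < e}" for n
    by (auto simp: A_def H_def)
  have pre: "{c\<in>space lebesgue. \<forall>k\<ge>n. \<bar>H k c - h (u k)\<bar> < e} \<in> sets lebesgue" for n
    by measurable
  have meas: "A n \<in> sets lebesgue" for n
    unfolding eq by (rule sets.Int[OF _ pre]) simp
  show "A n \<in> sets lebesgue" by (rule meas)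
  have "incseq A" unfolding A_def incseq_def by (auto intro: order_trans)
  have sub: "A n \<subseteq> {1..2}" for n unfolding A_def by blast
  have "(\<Union>n. A n) = {1..2::real}"
  proof (intro equalityI subsetI)
    fix c :: real assume c: "c \<in> {1..2}"
    have "(\<lambda>k. h (c * u k) - h (u k)) \<longlonglongrightarrow> 0"
      by (rule filterlim_compose[OF h u]) (use c in auto)
    from tendstoD[OF this e] have "\<forall>\<^sub>F k in sequentially. \<bar>h (c * u k) - h (u k)\<bar> < e"
      by (simp add: dist_real_def)
    then show "c \<in> (\<Union>n. A n)" using c by (auto simp: A_def eventually_sequentially)
  qed (use sub in blast)
  then have Un: "(\<Union>n. A n) = {1..2::real}" .
  have "(\<lambda>n. measure lebesgue (A n)) \<longlonglongrightarrow> measure lebesgue (\<Union>n. A n)"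
  proof (rule Lim_measure_incseq)
    show "range A \<subseteq> sets lebesgue" using meas by blast
    show "emeasure lebesgue (\<Union>n. A n) \<noteq> \<infinity>" unfolding Un by simp
  qed fact
  then show "(\<lambda>n. measure lebesgue (A n)) \<longlonglongrightarrow> 1" unfolding Un by simp
qed

text \<open>
  Apply the previous lemma to the base points \<open>u n\<close> and to \<open>l n * u n\<close>. Both exceptional
  sets are small, and since \<open>l n\<close> is near 1 the dilate of the second good set by \<open>l n\<close> must
  meet the first one. A common factor compares both \<open>h (u n)\<close> and \<open>h (l n * u n)\<close> with the
  same third value.
\<close>

lemma uniform_convergence_sequence:
  fixes h :: "real \<Rightarrow> real"
  assumes hm: "h \<in> borel_measurable lebesgue"
    and h: "\<And>c. c > 0 \<Longrightarrow> ((\<lambda>x. h (c * x) - h x) \<longlongrightarrow> 0) at_top"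
    and u: "filterlim u at_top sequentially" and l: "l \<longlonglongrightarrow> 1"
  shows "(\<lambda>n. h (l n * u n) - h (u n)) \<longlonglongrightarrow> 0"
proof (rule tendstoI)
  fix e :: real assume e: "e > 0"
  define A where "A = (\<lambda>u (n::nat). {c\<in>{1..2}. \<forall>k\<ge>n. \<bar>h (c * u k) - h (u k)\<bar> < e / 2})"
  have lu: "filterlim (\<lambda>n. l n * u n) at_top sequentially"
    by (rule filterlim_tendsto_pos_mult_at_top[OF l _ u]) simp
  have tr1: "A w n \<in> sets lebesgue" if "filterlim w at_top sequentially" for w n
    unfolding A_def
    by (rule measure_close_dilates(1)[OF hm _ that]) (use h e in \<open>blast, simp\<close>)
  have tr2: "(\<lambda>n. measure lebesgue (A w n)) \<longlonglongrightarrow> 1" if "filterlim w at_top sequentially" for w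
    unfolding A_def
    by (rule measure_close_dilates(2)[OF hm _ that]) (use h e in \<open>blast, simp\<close>)
  have ev: "\<forall>\<^sub>F n in sequentially. measure lebesgue (A u n) > 3/4"
    "\<forall>\<^sub>F n in sequentially. measure lebesgue (A (\<lambda>n. l n * u n) n) > 3/4"
    using order_tendstoD(1)[OF tr2[OF u], of "3/4"] order_tendstoD(1)[OF tr2[OF lu], of "3/4"] by simp_all
  have "\<forall>\<^sub>F n in sequentially. \<bar>l n - 1\<bar> < 1/16"
    using tendstoD[OF l, of "1/16"] by (simp add: dist_real_def)
  with ev show "\<forall>\<^sub>F n in sequentially. dist (h (l n * u n) - h (u n)) 0 < e"
  proof eventually_elim
    case (elim n)
    let ?A = "A u n" and ?B = "A (\<lambda>n. l n * u n) n"
    let ?C = "(\<lambda>c. l n * c) ` ?B"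
    have mA: "?A \<in> sets lebesgue" and mB: "?B \<in> sets lebesgue" using tr1[OF u] tr1[OF lu] by auto
    have l: "l n > 15/16" "l n < 17/16" using elim(3) unfolding abs_less_iff by linarith+
    have sub: "?A \<subseteq> {15/16..17/8}" "?C \<subseteq> {15/16..17/8}"
    proof -
      show "?A \<subseteq> {15/16..17/8}" by (auto simp: A_def)
      show "?C \<subseteq> {15/16..17/8}"
      proof clarify
        fix c assume "c \<in> ?B"
        then have c: "1 \<le> c" "c \<le> 2" by (auto simp: A_def)
        have "15/16 * 1 \<le> l n * c" "l n * c \<le> 17/16 * 2" using c l by (intro mult_mono; simp)+
        then show "l n * c \<in> {15/16..17/8}" by auto
      qed
    qed
    have C: "?C \<in> sets lebesgue" "measure lebesgue ?C = l n * measure lebesgue ?B"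
    proof -
      show "?C \<in> sets lebesgue"
        by (rule differentiable_image_in_sets_lebesgue[OF mB])
          (auto intro!: derivative_intros)
      show "measure lebesgue ?C = l n * measure lebesgue ?B"
        using measure_lebesgue_affine[of "l n" 0 ?B] l by simp
    qed
    \<comment> \<open>the two measures add up to more than 19/16, the length of the interval that contains both sets\<close>
    have "?A \<inter> ?C \<noteq> {}"
    proof
      assume disj: "?A \<inter> ?C = {}"
      have fin: "emeasure lebesgue S \<noteq> \<infinity>" if "S \<subseteq> {15/16..17/8}" for S :: "real set"
        using emeasure_mono[OF that, of lebesgue] by (auto simp: top_unique)
      have "measure lebesgue (?A \<union> ?C) = measure lebesgue ?A + measure lebesgue ?C"
        by (rule measure_Union[OF fin[OF sub(1)] fin[OF sub(2)] mA C(1) disj])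
      moreover have "measure lebesgue (?A \<union> ?C) \<le> measure lebesgue {15/16..17/8::real}"
        by (rule measure_mono_fmeasurable) (use sub mA C in auto)
      moreover have "15/16 * (3/4) \<le> l n * measure lebesgue ?B"
        using elim l by (intro mult_mono) auto
      ultimately show False using elim C by simp
    qed
    then obtain b where b: "b \<in> ?B" "l n * b \<in> ?A" by auto
    have "\<bar>h (l n * b * u n) - h (u n)\<bar> < e/2" using b(2) by (auto simp: A_def)
    moreover have "\<bar>h (l n * b * u n) - h (l n * u n)\<bar> < e/2"
      using b(1) by (auto simp: A_def mult_ac)
    ultimately show ?case unfolding dist_real_def by linarith
  qed
qed

text \<open>
  The uniform convergence theorem for slowly varying functions, near dilation factor 1.
  It follows from its sequential form, applied to the logarithm of \<open>f\<close>.
\<close>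

lemma uniform_convergence_theorem:
  fixes f :: "real \<Rightarrow> real"
  assumes f: "slowly_varying f" and e: "e > 0"
  obtains X d where "0 < d" "d < 1"
    "\<And>x l. x \<ge> X \<Longrightarrow> \<bar>l - 1\<bar> < d \<Longrightarrow> \<bar>f (l * x) / f x - 1\<bar> < e"
proof -
  obtain a where a: "\<And>x. x > a \<Longrightarrow> 0 < f x" and
    m: "f \<in> borel_measurable (lebesgue_on {a<..})"
    using assms unfolding slowly_varying_def by blast
  define h where "h = (\<lambda>x. ln (if x \<in> {a<..} then f x else 0))"
  have [measurable]: "(\<lambda>x. if x \<in> {a<..} then f x else 0) \<in> borel_measurable lebesgue"
    by (rule borel_measurable_if_I[OF m]) simp
  have hm: "h \<in> borel_measurable lebesgue" unfolding h_def by measurable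
  have hlim: "((\<lambda>x. h (c * x) - h x) \<longlongrightarrow> 0) at_top" if c: "c > 0" for c
  proof -
    have "((\<lambda>x. ln (f (c * x) / f x)) \<longlongrightarrow> ln 1) at_top"
      by (intro tendsto_intros slowly_varying_scale f c) auto
    moreover have "\<forall>\<^sub>F x in at_top. ln (f (c * x) / f x) = h (c * x) - h x"
      using eventually_gt_at_top[of a] eventually_gt_at_top[of "a / c"]
    proof eventually_elim
      case (elim x)
      then show ?case using a[of x] a[of "c * x"] c
        by (simp add: h_def ln_div pos_divide_less_eq mult.commute)
    qed
    ultimately show ?thesis by (simp add: filterlim_cong)
  qed
  have "\<exists>X d. 0 < d \<and> d < 1 \<and> (\<forall>x l. x \<ge> X \<longrightarrow> \<bar>l - 1\<bar> < d \<longrightarrow> \<bar>f (l * x) / f x - 1\<bar> < e)"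
  proof (rule ccontr)
    assume "\<not> ?thesis"
    then have "\<exists>x l. x \<ge> real n \<and> \<bar>l - 1\<bar> < 1 / (2 + real n) \<and> \<not> \<bar>f (l * x) / f x - 1\<bar> < e" for n :: nat
      by (auto dest!: spec[of _ "real n"] spec[of _ "1 / (2 + real n)"])
    then obtain u l where ul: "\<And>n. u n \<ge> real n" "\<And>n. \<bar>l n - 1\<bar> < 1 / (2 + real n)"
      "\<And>n. \<not> \<bar>f (l n * u n) / f (u n) - 1\<bar> < e" by metis
    have u: "filterlim u at_top sequentially"
      by (rule filterlim_at_top_mono[OF filterlim_real_sequentially]) (use ul in auto)
    have "(\<lambda>n. l n - 1) \<longlonglongrightarrow> 0"
    proof (rule Lim_null_comparison)
      show "\<forall>\<^sub>F n in sequentially. norm (l n - 1) \<le> 1 / (2 + real n)"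
        using ul(2) by (auto intro!: always_eventually less_imp_le)
      show "(\<lambda>n. 1 / (2 + real n)) \<longlonglongrightarrow> 0" by real_asymp
    qed
    then have l: "l \<longlonglongrightarrow> 1" by (simp add: LIM_zero_iff)
    have lu: "filterlim (\<lambda>n. l n * u n) at_top sequentially"
      by (rule filterlim_tendsto_pos_mult_at_top[OF l _ u]) simp
    have "(\<lambda>n. exp (h (l n * u n) - h (u n))) \<longlonglongrightarrow> exp 0"
      by (intro tendsto_exp uniform_convergence_sequence hm hlim u l)
    moreover have "\<forall>\<^sub>F n in sequentially. exp (h (l n * u n) - h (u n)) = f (l n * u n) / f (u n)"
      using filterlim_at_top_dense[THEN iffD1, OF u, rule_format, of a]
        filterlim_at_top_dense[THEN iffD1, OF lu, rule_format, of a]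
      by eventually_elim (simp add: h_def a exp_diff)
    ultimately have "(\<lambda>n. f (l n * u n) / f (u n)) \<longlonglongrightarrow> 1" by (simp add: filterlim_cong)
    then have "\<forall>\<^sub>F n in sequentially. \<bar>f (l n * u n) / f (u n) - 1\<bar> < e"
      using tendstoD[OF _ e] by (fastforce simp: dist_real_def)
    then show False using ul(3) by (auto simp: eventually_sequentially)
  qed
  then show ?thesis using that by blast
qed

text \<open>
  This is the form in which uniform convergence is used below: a slowly varying function
  respects asymptotic equivalence of divergent arguments, even when it is irregular.
\<close>

lemma slowly_varying_compose_equiv:
  assumes f: "slowly_varying f" and g: "filterlim g at_top F" and gh: "g \<sim>[F] h"
  shows "(\<lambda>x. f (g x)) \<sim>[F] (\<lambda>x. f (h x))"
proof (rule asymp_equiv_symI, rule asymp_equivI', rule tendstoI)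
  fix e :: real assume "e > 0"
  from uniform_convergence_theorem[OF f this] obtain X d where
    d: "0 < d" and X: "\<And>x l. x \<ge> X \<Longrightarrow> \<bar>l - 1\<bar> < d \<Longrightarrow> \<bar>f (l * x) / f x - 1\<bar> < e" by metis
  have pos: "\<forall>\<^sub>F x in F. g x > 0" using g by (auto simp: filterlim_at_top_dense)
  have "((\<lambda>x. h x / g x) \<longlongrightarrow> 1) F"
    by (rule asymp_equivD_strong[OF asymp_equiv_symI[OF gh]]) (use pos in eventually_elim, auto)
  then have "\<forall>\<^sub>F x in F. \<bar>h x / g x - 1\<bar> < d"
    using d by (auto dest: tendstoD simp: dist_real_def)
  moreover have "\<forall>\<^sub>F x in F. g x \<ge> X" using g by (auto simp: filterlim_at_top)
  ultimately show "\<forall>\<^sub>F x in F. dist (f (h x) / f (g x)) 1 < e" using pos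
  proof eventually_elim
    case (elim x)
    then show ?case using X[of "g x" "h x / g x"] by (simp add: dist_real_def)
  qed
qed

text \<open>
  Enlarging the argument by a factor \<open>q\<close> close to 1 costs \<open>f\<close> at most the factor
  \<open>q powr (-p/2)\<close>, so along geometric progressions \<open>f\<close> decays more slowly than
  \<open>x powr (-p/2)\<close>. Uniform convergence bounds \<open>f\<close> below on one interval \<open>[X, q X]\<close> of
  starting points, and every large \<open>x\<close> is reached from that interval.
\<close>

lemma slowly_varying_powr_mult_at_top:
  assumes f: "slowly_varying f" and p: "p > 0"
  shows "filterlim (\<lambda>x. x powr p * f x) at_top at_top"
proof -
  obtain X1 d where d: "0 < d" "d < 1"
    and X1: "\<And>x l. x \<ge> X1 \<Longrightarrow> \<bar>l - 1\<bar> < d \<Longrightarrow> \<bar>f (l * x) / f x - 1\<bar> < 1/2"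
    using uniform_convergence_theorem[OF f, of "1/2"] by (metis half_gt_zero zero_less_one)
  define q where "q = 1 + d / 2"
  have q: "q > 1" "q - 1 < d" using d by (auto simp: q_def)
  have "((\<lambda>x. f (q * x) / f x) \<longlongrightarrow> 1) at_top" using slowly_varying_scale[OF f] q by simp
  moreover have "q powr (-p/2) < 1" using q p by (simp add: powr_less_one)
  ultimately have "\<forall>\<^sub>F x in at_top. f (q * x) / f x > q powr (-p/2)" by (rule order_tendstoD)
  then obtain X2 where X2: "\<And>x. x \<ge> X2 \<Longrightarrow> f (q * x) / f x > q powr (-p/2)"
    by (auto simp: eventually_at_top_linorder)
  obtain X3 where X3: "\<And>x. x \<ge> X3 \<Longrightarrow> f x > 0"
    using slowly_varying_eventually_pos[OF f] by (auto simp: eventually_at_top_linorder)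
  define X where "X = Max {X1, X2, X3, 1}"
  have X: "X \<ge> X1" "X \<ge> X2" "X \<ge> X3" "X \<ge> 1" by (auto simp: X_def)
  define m where "m = f X / 2"
  have m: "m > 0" using X3[of X] X by (simp add: m_def)
  have low: "f y \<ge> m" if "X \<le> y" "y \<le> q * X" for y
  proof -
    have "\<bar>y / X - 1\<bar> < d"
    proof -
      have "1 \<le> y / X" "y / X \<le> q" using that X by (auto simp: field_simps)
      then show ?thesis using q by auto
    qed
    then have "\<bar>f (y / X * X) / f X - 1\<bar> < 1/2" by (intro X1) (use X in auto)
    then have "f (y / X * X) / f X > 1/2" unfolding abs_less_iff by linarith
    then have "f y / f X > 1/2" using X by simp
    then show ?thesis using X3[of X] X by (simp add: m_def field_simps)
  qed
  have iter: "f (q ^ n * y) \<ge> (q powr (-p/2)) ^ n * m" if "X \<le> y" "y \<le> q * X" for y n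
  proof (induction n)
    case 0 then show ?case using low that by simp
  next
    case (Suc n)
    have "y \<le> q ^ n * y" using q that X by (simp add: mult_ge1_I one_le_power)
    then have ge: "q ^ n * y \<ge> X" using that by simp
    have "(q powr (-p/2)) * ((q powr (-p/2)) ^ n * m) \<le> q powr (-p/2) * f (q ^ n * y)"
      by (intro mult_left_mono Suc.IH) auto
    also have "\<dots> \<le> f (q * (q ^ n * y))"
      using X2[of "q ^ n * y"] X3[of "q ^ n * y"] ge X by (simp add: field_simps)
    finally show ?case by (simp add: mult.assoc)
  qed
  have bound: "x powr p * f x \<ge> (m / (q * X) powr (p/2)) * x powr (p/2)" if x: "x \<ge> X" for x
  proof -
    define n where "n = nat \<lfloor>log q (x / X)\<rfloor>"
    define y where "y = x / q ^ n"
    have xX: "x / X \<ge> 1" using x X by auto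
    have lg: "log q (x / X) \<ge> 0" using q xX by simp
    have n: "real n \<le> log q (x / X)" "log q (x / X) < real n + 1" using lg unfolding n_def by linarith+
    have "q powr real n \<le> x / X" using n(1) q xX by (simp add: le_log_iff)
    then have y1: "y \<ge> X" using q X by (simp add: y_def powr_realpow field_simps)
    have "x / X < q powr (real n + 1)" using n(2) q xX by (simp add: log_less_iff)
    then have y2: "y \<le> q * X" using q X by (simp add: y_def powr_realpow powr_add field_simps)
    have xy: "x = q ^ n * y" using q by (simp add: y_def)
    have "(q powr (-p/2)) ^ n = (q ^ n) powr (-p/2)"
      using q by (simp add: powr_power powr_powr mult.commute flip: powr_realpow)
    also have "\<dots> = (x / y) powr (-p/2)" using xy y1 X by simp
    also have "\<dots> = x powr (-p/2) * y powr (p/2)" using x y1 X by (simp add: powr_divide powr_minus field_simps)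
    finally have 1: "(q powr (-p/2)) ^ n = x powr (-p/2) * y powr (p/2)" .
    have y0: "y powr (p/2) \<ge> 1" using y1 X p by (simp add: ge_one_powr_ge_zero)
    have "x powr (p/2) * m = x powr p * (x powr (-p/2) * 1 * m)"
      using x X by (simp flip: powr_add)
    also have "\<dots> \<le> x powr p * (x powr (-p/2) * y powr (p/2) * m)"
      using y0 m by (intro mult_left_mono mult_right_mono) auto
    also have "\<dots> \<le> x powr p * f x"
      using iter[OF y1 y2, of n] xy 1 by (intro mult_left_mono) auto
    finally have 2: "x powr (p/2) * m \<le> x powr p * f x" .
    have "1 \<le> (q * X) powr (p/2)"
      using p y1 y2 X by (intro ge_one_powr_ge_zero) auto
    then have "(m / (q * X) powr (p/2)) * x powr (p/2) \<le> m * x powr (p/2)"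
      using m by (intro mult_right_mono) (auto simp: divide_le_eq)
    then show ?thesis using 2 by (simp add: mult.commute)
  qed
  have "filterlim (\<lambda>x::real. (m / (q * X) powr (p/2)) * x powr (p/2)) at_top at_top"
    by (rule filterlim_tendsto_pos_mult_at_top[OF tendsto_const])
      (use m q X p in \<open>auto intro!: real_powr_at_top\<close>)
  then show ?thesis
    by (rule filterlim_at_top_mono) (use bound in \<open>auto simp: eventually_at_top_linorder\<close>)
qed

section \<open>Weak convergence of laws on the unit interval\<close>

lemma (in real_distribution) integrable_on_unit_interval:
  fixes f :: "real \<Rightarrow> real"
  assumes "AE x in M. x \<in> {0..1}" "f \<in> borel_measurable borel" "\<And>x. x \<in> {0..1} \<Longrightarrow> \<bar>f x\<bar> \<le> B"
  shows "integrable M f"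
proof (rule integrable_const_bound)
  show "AE x in M. norm (f x) \<le> B" using assms(1) by eventually_elim (use assms(3) in auto)
qed (use assms(2) in simp)

text \<open>
  The test functions whose integrals converge form a set that is closed under uniform
  limits on the unit interval. Both lemmas that follow are applications.
\<close>

lemma integral_tendsto_uniform_approx:
  fixes M :: "nat \<Rightarrow> real measure" and f :: "real \<Rightarrow> real"
  assumes M: "\<And>n. real_distribution (M n)" and N: "real_distribution N"
    and AM: "\<And>n. AE x in M n. x \<in> {0..1}" and AN: "AE x in N. x \<in> {0..1}"
    and f: "f \<in> borel_measurable borel" "\<And>x. x \<in> {0..1} \<Longrightarrow> \<bar>f x\<bar> \<le> B"
    and approx: "\<And>e. e > 0 \<Longrightarrow> \<exists>p\<in>borel_measurable borel. (\<forall>x\<in>{0..1}. \<bar>f x - p x\<bar> \<le> e) \<and>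
          (\<lambda>n. \<integral>x. p x \<partial>M n) \<longlonglongrightarrow> (\<integral>x. p x \<partial>N)"
  shows "(\<lambda>n. \<integral>x. f x \<partial>M n) \<longlonglongrightarrow> (\<integral>x. f x \<partial>N)"
proof (rule tendstoI)
  fix e :: real assume e: "e > 0"
  obtain p where p: "p \<in> borel_measurable borel" "\<And>x. x \<in> {0..1} \<Longrightarrow> \<bar>f x - p x\<bar> \<le> e / 4"
    "(\<lambda>n. \<integral>x. p x \<partial>M n) \<longlonglongrightarrow> (\<integral>x. p x \<partial>N)"
    using approx[of "e/4"] e by auto
  have close: "\<bar>(\<integral>x. f x \<partial>Q) - (\<integral>x. p x \<partial>Q)\<bar> \<le> e / 4"
    if Q: "real_distribution Q" and A: "AE x in Q. x \<in> {0..1}" for Q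
  proof -
    interpret real_distribution Q by fact
    have "\<bar>p x\<bar> \<le> B + e / 4" if "x \<in> {0..1}" for x using p(2)[OF that] f(2)[OF that] by linarith
    then have i: "integrable Q f" "integrable Q p"
      using integrable_on_unit_interval[OF A f] integrable_on_unit_interval[OF A p(1)] by auto
    have "(\<integral>x. f x \<partial>Q) - (\<integral>x. p x \<partial>Q) = (\<integral>x. f x - p x \<partial>Q)" using i by simp
    also have "\<bar>\<dots>\<bar> \<le> (\<integral>x. \<bar>f x - p x\<bar> \<partial>Q)" by (rule integral_abs_bound)
    also have "\<dots> \<le> (\<integral>x. e / 4 \<partial>Q)"
    proof (rule integral_mono_AE)
      show "AE x in Q. \<bar>f x - p x\<bar> \<le> e / 4" using A by eventually_elim (use p(2) in auto)
    qed (use i in auto)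
    finally show ?thesis using prob_space by simp
  qed
  have "\<forall>\<^sub>F n in sequentially. dist (\<integral>x. p x \<partial>M n) (\<integral>x. p x \<partial>N) < e / 4"
    using tendstoD[OF p(3), of "e/4"] e by simp
  then show "\<forall>\<^sub>F n in sequentially. dist (\<integral>x. f x \<partial>M n) (\<integral>x. f x \<partial>N) < e"
  proof eventually_elim
    case (elim n)
    show ?case using elim close[OF M AM, of n] close[OF N AN] e unfolding dist_real_def by linarith
  qed
qed

text \<open>
  Polynomials are uniformly dense among the continuous functions on the unit interval.
\<close>

lemma weak_conv_of_moments:
  fixes M :: "nat \<Rightarrow> real measure"
  assumes M: "\<And>n. real_distribution (M n)" and N: "real_distribution N"
    and AM: "\<And>n. AE x in M n. x \<in> {0..1}" and AN: "AE x in N. x \<in> {0..1}"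
    and mom: "\<And>k. (\<lambda>n. \<integral>x. x ^ k \<partial>M n) \<longlonglongrightarrow> (\<integral>x. x ^ k \<partial>N)"
  shows "weak_conv_m M N"
proof (rule integral_cts_step_conv_imp_weak_conv[OF M N])
  fix a b :: real assume ab: "a < b"
  have cont: "continuous_on UNIV (cts_step a b)"
    using cts_step_uniformly_continuous[OF ab] uniformly_continuous_imp_continuous by blast
  show "(\<lambda>n. integral\<^sup>L (M n) (cts_step a b)) \<longlonglongrightarrow> integral\<^sup>L N (cts_step a b)"
  proof (rule integral_tendsto_uniform_approx[OF M N AM AN])
    show "cts_step a b \<in> borel_measurable borel" using cont by (rule borel_measurable_continuous_onI)
    show "\<bar>cts_step a b x\<bar> \<le> 1" for x using ab by (auto simp: cts_step_def)
    fix e :: real assume e: "e > 0"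
    obtain g where g: "real_polynomial_function g" "\<And>x. x \<in> {0..1} \<Longrightarrow> \<bar>cts_step a b x - g x\<bar> < e"
      using Stone_Weierstrass_real_polynomial_function[OF _ continuous_on_subset[OF cont subset_UNIV] e, of "{0..1}"]
      by (auto simp: compact_Icc)
    then obtain c n where gc: "g = (\<lambda>x. \<Sum>i\<le>n. c i * x ^ i)"
      unfolding real_polynomial_function_iff_sum by blast
    have int: "(\<integral>x. g x \<partial>Q) = (\<Sum>i\<le>n. c i * (\<integral>x. x ^ i \<partial>Q))"
      if Q: "real_distribution Q" and A: "AE x in Q. x \<in> {0..1}" for Q
    proof -
      interpret real_distribution Q by fact
      have "integrable Q (\<lambda>x. x ^ i)" for i
        by (rule integrable_on_unit_interval[OF A, of _ 1]) (auto simp: power_abs intro: power_le_one)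
      then show ?thesis unfolding gc by (subst Bochner_Integration.integral_sum) auto
    qed
    have "(\<lambda>k. \<integral>x. g x \<partial>M k) \<longlonglongrightarrow> (\<integral>x. g x \<partial>N)"
      unfolding int[OF M AM] int[OF N AN] by (intro tendsto_intros mom)
    moreover have "g \<in> borel_measurable borel" unfolding gc by measurable
    ultimately show "\<exists>p\<in>borel_measurable borel. (\<forall>x\<in>{0..1}. \<bar>cts_step a b x - p x\<bar> \<le> e) \<and>
          (\<lambda>n. \<integral>x. p x \<partial>M n) \<longlonglongrightarrow> (\<integral>x. p x \<partial>N)"
      using g(2) by (intro bexI[of _ g]) (auto intro: less_imp_le)
  qed
qed

text \<open>
  The moments are recovered one at a time. The functions \<open>x ^ k / (1 - q x)\<close> approximate
  \<open>x ^ k\<close> uniformly as \<open>q\<close> tends to 0, so convergence of their integrals for all small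
  \<open>q\<close> gives the \<open>k\<close>-th moment; and
  \<open>x ^ Suc k / (1 - q x) = (x ^ k / (1 - q x) - x ^ k) / q\<close> leads from \<open>k\<close> to \<open>Suc k\<close>.
\<close>

lemma weak_conv_of_geometric_transforms:
  fixes M :: "nat \<Rightarrow> real measure"
  assumes M: "\<And>n. real_distribution (M n)" and N: "real_distribution N"
    and AM: "\<And>n. AE x in M n. x \<in> {0..1}" and AN: "AE x in N. x \<in> {0..1}"
    and tr: "\<And>q. q \<in> {0<..<1} \<Longrightarrow> (\<lambda>n. \<integral>x. 1 / (1 - q * x) \<partial>M n) \<longlonglongrightarrow> (\<integral>x. 1 / (1 - q * x) \<partial>N)"
  shows "weak_conv_m M N"
proof (rule weak_conv_of_moments[OF M N AM AN])
  have den: "1 - q \<le> 1 - q * x" "1 - q * x \<le> 1" if "q \<in> {0<..<1}" "x \<in> {0..1}" for q x :: real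
    using that mult_left_le[of x q] by (auto intro: order_le_less_trans)
  have den0: "0 < 1 - q * x" if "q \<in> {0<..<1}" "x \<in> {0..1}" for q x :: real
    using den(1)[OF that] that(1) unfolding greaterThanLessThan_iff by linarith
  have bnd: "\<bar>x ^ k / (1 - q * x)\<bar> \<le> 1 / (1 - q)" if "q \<in> {0<..<1}" "x \<in> {0..1}" for q x :: real and k
  proof -
    have "x ^ k \<le> 1" "0 \<le> x ^ k" using that by (auto intro: power_le_one)
    moreover have "0 < 1 - q * x" by (rule den0[OF that])
    ultimately have "\<bar>x ^ k / (1 - q * x)\<bar> = x ^ k / (1 - q * x)" by simp
    also have "\<dots> \<le> 1 / (1 - q)" using den[OF that] that \<open>x ^ k \<le> 1\<close> \<open>0 \<le> x ^ k\<close>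
      by (intro frac_le) auto
    finally show ?thesis .
  qed
  have moment: "(\<lambda>n. \<integral>x. x ^ k \<partial>M n) \<longlonglongrightarrow> (\<integral>x. x ^ k \<partial>N)"
    if *: "\<And>q. q \<in> {0<..<1} \<Longrightarrow>
        (\<lambda>n. \<integral>x. x ^ k / (1 - q * x) \<partial>M n) \<longlonglongrightarrow> (\<integral>x. x ^ k / (1 - q * x) \<partial>N)" for k
  proof (rule integral_tendsto_uniform_approx[OF M N AM AN])
    show "\<bar>x ^ k\<bar> \<le> 1" if "x \<in> {0..1}" for x :: real using that by (auto simp: power_abs intro: power_le_one)
    fix e :: real assume e: "e > 0"
    \<comment> \<open>chosen so that \<open>q / (1 - q) = e\<close>\<close>
    define q where "q = e / (1 + e)"
    have q: "q \<in> {0<..<1}" "q / (1 - q) = e" using e by (auto simp: q_def field_simps)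
    have "\<bar>x ^ k - x ^ k / (1 - q * x)\<bar> \<le> e" if x: "x \<in> {0..1}" for x
    proof -
      have "0 < 1 - q * x" by (rule den0[OF q(1) x])
      then have "x ^ k - x ^ k / (1 - q * x) = - (q * x ^ Suc k / (1 - q * x))"
        by (simp add: field_simps)
      then have "\<bar>x ^ k - x ^ k / (1 - q * x)\<bar> = q * \<bar>x ^ Suc k / (1 - q * x)\<bar>"
        using q by (simp add: abs_mult)
      also have "\<dots> \<le> q * (1 / (1 - q))" using bnd[OF q(1) x, of "Suc k"] q by (intro mult_left_mono) auto
      finally show ?thesis using q by simp
    qed
    then show "\<exists>p\<in>borel_measurable borel. (\<forall>x\<in>{0..1}. \<bar>x ^ k - p x\<bar> \<le> e) \<and>
          (\<lambda>n. \<integral>x. p x \<partial>M n) \<longlonglongrightarrow> (\<integral>x. p x \<partial>N)"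
      using *[OF q(1)] by (intro bexI[of _ "\<lambda>x. x ^ k / (1 - q * x)"]) auto
  qed simp
  have "(\<lambda>n. \<integral>x. x ^ k / (1 - q * x) \<partial>M n) \<longlonglongrightarrow> (\<integral>x. x ^ k / (1 - q * x) \<partial>N)"
    if q: "q \<in> {0<..<1}" for q k using q
  proof (induction k arbitrary: q)
    case 0
    then show ?case using tr by simp
  next
    case (Suc k)
    have rec: "(\<integral>x. x ^ Suc k / (1 - q * x) \<partial>Q) =
        ((\<integral>x. x ^ k / (1 - q * x) \<partial>Q) - (\<integral>x. x ^ k \<partial>Q)) / q"
      if Q: "real_distribution Q" and A: "AE x in Q. x \<in> {0..1}" for Q
    proof -
      interpret real_distribution Q by fact
      have i1: "integrable Q (\<lambda>x. x ^ k / (1 - q * x))"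
        by (rule integrable_on_unit_interval[OF A _ bnd[OF Suc.prems]]) measurable
      have i2: "integrable Q (\<lambda>x. x ^ k)"
        by (rule integrable_on_unit_interval[OF A, of _ 1]) (auto simp: power_abs intro: power_le_one)
      have "(\<integral>x. x ^ Suc k / (1 - q * x) \<partial>Q) = (\<integral>x. (x ^ k / (1 - q * x) - x ^ k) / q \<partial>Q)"
      proof (rule integral_cong_AE)
        show "AE x in Q. x ^ Suc k / (1 - q * x) = (x ^ k / (1 - q * x) - x ^ k) / q"
          using A
        proof eventually_elim
          case (elim x)
          have "0 < 1 - q * x" by (rule den0[OF Suc.prems elim])
          then have "x ^ k / (1 - q * x) - x ^ k = q * (x ^ Suc k / (1 - q * x))"
            by (simp add: field_simps)
          then show ?case using Suc.prems by simp
        qed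
      qed auto
      also have "\<dots> = ((\<integral>x. x ^ k / (1 - q * x) \<partial>Q) - (\<integral>x. x ^ k \<partial>Q)) / q"
        using i1 i2 by simp
      finally show ?thesis .
    qed
    show ?case unfolding rec[OF M AM] rec[OF N AN]
    proof (rule tendsto_divide[OF tendsto_diff[OF Suc.IH[OF Suc.prems] moment] tendsto_const])
      show "q \<noteq> 0" using Suc.prems by simp
    qed (rule Suc.IH)
  qed
  then show "(\<lambda>n. \<integral>x. x ^ k \<partial>M n) \<longlonglongrightarrow> (\<integral>x. x ^ k \<partial>N)" for k by (rule moment)
qed

section \<open>The generalized arcsine law\<close>

lemma Gamma_reflection_real:
  "Gamma x * Gamma (1 - x) = pi / sin (pi * x)" for x :: real
proof -
  have "complex_of_real (Gamma x) * complex_of_real (Gamma (1 - x)) = complex_of_real pi / complex_of_real (sin (pi * x))"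
    using Gamma_reflection_complex[of "complex_of_real x"]
    unfolding Gamma_complex_of_real[symmetric] sin_of_real[symmetric] by simp
  then have "complex_of_real (Gamma x * Gamma (1 - x)) = complex_of_real (pi / sin (pi * x))"
    unfolding of_real_mult of_real_divide .
  then show ?thesis unfolding of_real_eq_iff .
qed

text \<open>
  The constant arises below as \<open>\<integral>\<^sub>0\<^sup>1 ((1 - w) / w) powr \<alpha> dw\<close>, which is this Beta
  integral and makes sense uniformly in \<open>\<alpha>\<close>, including \<open>\<alpha> = 0\<close>.
\<close>

lemma stieltjes_const_Beta:
  assumes "0 \<le> \<alpha>" "\<alpha> < 1"
  shows "stieltjes_const \<alpha> = Beta (1 + \<alpha>) (1 - \<alpha>)"
proof (cases "\<alpha> = 0")
  case True then show ?thesis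
    using Gamma_plus1[of "1::real"] by (simp add: stieltjes_const_def Beta_def)
next
  case False
  have "\<alpha> \<notin> \<int>\<^sub>\<le>\<^sub>0" using assms False by (auto elim!: nonpos_Ints_cases)
  then have "Gamma (1 + \<alpha>) = \<alpha> * Gamma \<alpha>" using Gamma_plus1[of \<alpha>] by (simp add: add.commute)
  moreover have "Gamma (2::real) = 1" using Gamma_plus1[of "1::real"] by simp
  ultimately show ?thesis using False Gamma_reflection_real[of \<alpha>]
    by (simp add: stieltjes_const_def Beta_def mult.assoc)
qed

text \<open>
  The Beta distribution with parameters \<open>1 - \<alpha>\<close> and \<open>\<alpha>\<close>, which degenerates to the point
  mass at 1 as \<open>\<alpha>\<close> tends to 0.
\<close>

definition generalized_arcsine :: "real \<Rightarrow> real measure" where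
  "generalized_arcsine \<alpha> = (if \<alpha> = 0 then return borel 1 else
     density lborel (\<lambda>x. ennreal (indicator {0<..<1} x *
       (x powr (- \<alpha>) * (1 - x) powr (\<alpha> - 1) / Beta (1 - \<alpha>) \<alpha>))))"

lemma Beta_integral:
  fixes a b :: real
  assumes "a > 0" "b > 0"
  shows "has_bochner_integral lborel
    (\<lambda>x. indicator {0<..<1} x * (x powr (a - 1) * (1 - x) powr (b - 1))) (Beta a b)"
proof -
  have "((\<lambda>x. x powr (a - 1) * (1 - x) powr (b - 1)) has_integral Beta a b) {0<..<1}"
    using has_integral_Beta_real[OF assms] by (simp add: has_integral_Icc_iff_Ioo)
  then have *: "(\<integral>\<^sup>+x. ennreal (indicator {0<..<1} x * (x powr (a - 1) * (1 - x) powr (b - 1))) \<partial>lborel) = ennreal (Beta a b)"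
    by (intro nn_integral_has_integral_lebesgue) auto
  show ?thesis
    by (rule has_bochner_integral_nn_integral[OF _ _ _ *])
      (use assms in \<open>auto simp: Beta_def intro!: divide_nonneg_pos mult_nonneg_nonneg less_imp_le[OF Gamma_real_pos] Gamma_real_pos\<close>)
qed

lemma Beta_complement:
  assumes "0 < \<alpha>" "\<alpha> < 1"
  shows "Beta (1 - \<alpha>) \<alpha> = pi / sin (pi * \<alpha>)" and "Beta (1 - \<alpha>) \<alpha> > 0"
proof -
  show "Beta (1 - \<alpha>) \<alpha> = pi / sin (pi * \<alpha>)"
    using Gamma_reflection_real[of \<alpha>] by (simp add: Beta_def mult.commute)
  moreover have "sin (pi * \<alpha>) > 0" using assms by (intro sin_gt_zero) auto
  ultimately show "Beta (1 - \<alpha>) \<alpha> > 0" by simp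
qed

lemma integral_generalized_arcsine:
  fixes f :: "real \<Rightarrow> real"
  assumes "0 < \<alpha>" "\<alpha> < 1" and f: "f \<in> borel_measurable borel"
    and i: "has_bochner_integral lborel
      (\<lambda>x. indicator {0<..<1} x * (x powr (- \<alpha>) * (1 - x) powr (\<alpha> - 1) * f x)) I"
  shows "has_bochner_integral (generalized_arcsine \<alpha>) f (I / Beta (1 - \<alpha>) \<alpha>)"
proof -
  have "has_bochner_integral (density lborel (\<lambda>x. ennreal (indicator {0<..<1} x *
       (x powr (- \<alpha>) * (1 - x) powr (\<alpha> - 1) / Beta (1 - \<alpha>) \<alpha>)))) f (I / Beta (1 - \<alpha>) \<alpha>)"
  proof (rule has_bochner_integral_density)
    have "has_bochner_integral lborel
      (\<lambda>x. indicator {0<..<1} x * (x powr (- \<alpha>) * (1 - x) powr (\<alpha> - 1) * f x) / Beta (1 - \<alpha>) \<alpha>) (I / Beta (1 - \<alpha>) \<alpha>)"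
      by (rule has_bochner_integral_divide_zero[OF i])
    then show "has_bochner_integral lborel (\<lambda>x. (indicator {0<..<1} x *
       (x powr (- \<alpha>) * (1 - x) powr (\<alpha> - 1) / Beta (1 - \<alpha>) \<alpha>)) *\<^sub>R f x) (I / Beta (1 - \<alpha>) \<alpha>)"
      by (simp add: mult.assoc)
    show "AE x in lborel. 0 \<le> indicator {0<..<1} x *
       (x powr (- \<alpha>) * (1 - x) powr (\<alpha> - 1) / Beta (1 - \<alpha>) \<alpha>)"
      using Beta_complement(2)[of \<alpha>] assms(1,2) by (intro always_eventually) auto
  qed (use f in auto)
  then show ?thesis using assms by (simp add: generalized_arcsine_def)
qed

lemma AE_generalized_arcsine:
  assumes "0 \<le> \<alpha>" "\<alpha> < 1"
  shows "AE x in generalized_arcsine \<alpha>. x \<in> {0..1}"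
proof (cases "\<alpha> = 0")
  case True
  then have eq: "generalized_arcsine \<alpha> = return borel 1" by (simp add: generalized_arcsine_def)
  show ?thesis unfolding eq by (subst AE_return) auto
next
  case False
  have [measurable]: "(\<lambda>x::real. ennreal (indicator {0<..<1} x *
       (x powr (- \<alpha>) * (1 - x) powr (\<alpha> - 1) / Beta (1 - \<alpha>) \<alpha>))) \<in> borel_measurable lborel" by measurable
  have eq: "generalized_arcsine \<alpha> = density lborel (\<lambda>x. ennreal (indicator {0<..<1} x *
       (x powr (- \<alpha>) * (1 - x) powr (\<alpha> - 1) / Beta (1 - \<alpha>) \<alpha>)))"
    using False by (simp add: generalized_arcsine_def)
  show ?thesis unfolding eq by (subst AE_density) (auto simp: indicator_def)
qed

lemma generalized_arcsine_moment:
  assumes "0 \<le> \<alpha>" "\<alpha> < 1"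
  shows "has_bochner_integral (generalized_arcsine \<alpha>) (\<lambda>x. x ^ k) (pochhammer (1 - \<alpha>) k / fact k)"
proof (cases "\<alpha> = 0")
  case True
  interpret prob_space "return borel (1::real)" by (rule prob_space_return) simp
  have "integrable (return borel (1::real)) (\<lambda>x. x ^ k)"
    by (rule integrable_const_bound[where B = 1]) (auto simp: AE_return)
  then have "has_bochner_integral (return borel 1) (\<lambda>x::real. x ^ k) (1 ^ k)"
    unfolding has_bochner_integral_iff by (simp add: integral_return)
  then show ?thesis using True by (simp add: generalized_arcsine_def pochhammer_fact[symmetric])
next
  case False
  then have a: "0 < \<alpha>" using assms by simp
  have nn: "1 - \<alpha> \<notin> \<int>\<^sub>\<le>\<^sub>0" using assms by (auto elim!: nonpos_Ints_cases)
  have "has_bochner_integral lborel (\<lambda>x. indicator {0<..<1} x * (x powr ((real k + 1 - \<alpha>) - 1) * (1 - x) powr (\<alpha> - 1)))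
      (Beta (real k + 1 - \<alpha>) \<alpha>)"
    by (rule Beta_integral) (use a assms in auto)
  also have "(\<lambda>x::real. indicator {0<..<1} x * (x powr ((real k + 1 - \<alpha>) - 1) * (1 - x) powr (\<alpha> - 1))) =
     (\<lambda>x. indicator {0<..<1} x * (x powr (- \<alpha>) * (1 - x) powr (\<alpha> - 1) * x ^ k))"
    by (auto simp: fun_eq_iff indicator_def powr_realpow[symmetric] powr_add[symmetric])
  finally have "has_bochner_integral (generalized_arcsine \<alpha>) (\<lambda>x. x ^ k) (Beta (real k + 1 - \<alpha>) \<alpha> / Beta (1 - \<alpha>) \<alpha>)"
    by (intro integral_generalized_arcsine a assms) auto
  moreover have "Beta (real k + 1 - \<alpha>) \<alpha> / Beta (1 - \<alpha>) \<alpha> = pochhammer (1 - \<alpha>) k / fact k"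
  proof -
    have "Gamma \<alpha> > 0" "Gamma (1 - \<alpha>) > 0" using a assms by (auto intro: Gamma_real_pos)
    moreover have "pochhammer (1 - \<alpha>) k = Gamma (1 - \<alpha> + real k) / Gamma (1 - \<alpha>)"
      using pochhammer_Gamma[OF nn] by simp
    moreover have "Gamma (1 + real k) = fact k" using Gamma_fact[of k, where 'a = real] by simp
    ultimately show ?thesis by (simp add: Beta_def field_simps)
  qed
  ultimately show ?thesis by simp
qed

lemma real_distribution_generalized_arcsine:
  assumes "0 \<le> \<alpha>" "\<alpha> < 1"
  shows "real_distribution (generalized_arcsine \<alpha>)"
proof -
  have "has_bochner_integral (generalized_arcsine \<alpha>) (\<lambda>x. 1::real) 1"
    using generalized_arcsine_moment[OF assms, of 0] by simp
  then have "integrable (generalized_arcsine \<alpha>) (\<lambda>x. 1::real)" "(\<integral>x. (1::real) \<partial>generalized_arcsine \<alpha>) = 1"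
    unfolding has_bochner_integral_iff by auto
  then have "(\<integral>\<^sup>+x. ennreal 1 \<partial>generalized_arcsine \<alpha>) = ennreal 1"
    using nn_integral_eq_integral[of "generalized_arcsine \<alpha>" "\<lambda>x. 1::real"] by simp
  then have "prob_space (generalized_arcsine \<alpha>)" by (intro prob_spaceI) simp
  moreover have "sets (generalized_arcsine \<alpha>) = sets borel" by (simp add: generalized_arcsine_def)
  ultimately show ?thesis
    by (simp add: real_distribution_def real_distribution_axioms_def sets_eq_imp_space_eq)
qed

text \<open>
  Expanding the geometric series turns the integral into the series of moments
  \<open>q ^ k * pochhammer (1 - \<alpha>) k / fact k\<close>, which is the binomial series of
  \<open>(1 - q) powr (\<alpha> - 1)\<close>.
\<close>

lemma generalized_arcsine_geometric:
  assumes "0 \<le> \<alpha>" "\<alpha> < 1" and q: "q \<in> {0<..<1}"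
  shows "(\<integral>x. 1 / (1 - q * x) \<partial>generalized_arcsine \<alpha>) = (1 - q) powr (\<alpha> - 1)"
proof -
  interpret N: real_distribution "generalized_arcsine \<alpha>"
    by (rule real_distribution_generalized_arcsine) fact+
  note AN = AE_generalized_arcsine[OF assms(1,2)]
  note mom = generalized_arcsine_moment[OF assms(1,2)]
  have series: "(\<lambda>k. q ^ k * (pochhammer (1 - \<alpha>) k / fact k)) sums ((1 - q) powr (\<alpha> - 1))"
  proof -
    have "(\<lambda>k. ((\<alpha> - 1) gchoose k) * (- q) ^ k) sums (1 + - q) powr (\<alpha> - 1)"
      using q by (intro gen_binomial_real) auto
    moreover have "((\<alpha> - 1) gchoose k) * (- q) ^ k = q ^ k * (pochhammer (1 - \<alpha>) k / fact k)" for k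
    proof -
      have "((\<alpha> - 1) gchoose k) * (- q) ^ k = ((-1) ^ k * (-1) ^ k) * (q ^ k * (pochhammer (1 - \<alpha>) k / fact k))"
        unfolding gbinomial_pochhammer power_minus[of q k] by simp
      also have "(-1) ^ k * (-1) ^ k = (1::real)" unfolding power_mult_distrib[symmetric] by simp
      finally show ?thesis by simp
    qed
    ultimately show ?thesis by simp
  qed
  have int: "integrable (generalized_arcsine \<alpha>) (\<lambda>x. (q * x) ^ k)"
    and intv: "(\<integral>x. (q * x) ^ k \<partial>generalized_arcsine \<alpha>) = q ^ k * (pochhammer (1 - \<alpha>) k / fact k)" for k
    using mom[of k] by (auto simp: power_mult_distrib has_bochner_integral_iff)
  have nrm: "(\<integral>x. norm ((q * x) ^ k) \<partial>generalized_arcsine \<alpha>) = (\<integral>x. (q * x) ^ k \<partial>generalized_arcsine \<alpha>)" for k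
  proof (rule integral_cong_AE)
    show "AE x in generalized_arcsine \<alpha>. norm ((q * x) ^ k) = (q * x) ^ k"
      using AN by eventually_elim (use q in \<open>auto simp: abs_mult power_abs\<close>)
  qed auto
  have lt: "q * x < 1" "0 \<le> q * x" if "x \<in> {0..1}" for x
  proof -
    have "q * x \<le> q * 1" using q that by (intro mult_left_mono) auto
    then show "q * x < 1" using q unfolding greaterThanLessThan_iff by linarith
    show "0 \<le> q * x" using q that by auto
  qed
  have "(\<lambda>k. \<integral>x. (q * x) ^ k \<partial>generalized_arcsine \<alpha>) sums (\<integral>x. (\<Sum>k. (q * x) ^ k) \<partial>generalized_arcsine \<alpha>)"
  proof (rule sums_integral[OF int])
    show "AE x in generalized_arcsine \<alpha>. summable (\<lambda>k. norm ((q * x) ^ k))"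
      using AN
    proof eventually_elim
      case (elim x)
      then show ?case using lt[OF elim] by (simp add: norm_power summable_geometric)
    qed
    show "summable (\<lambda>k. \<integral>x. norm ((q * x) ^ k) \<partial>generalized_arcsine \<alpha>)"
      unfolding nrm intv using series by (rule sums_summable)
  qed
  then have "(\<integral>x. (\<Sum>k. (q * x) ^ k) \<partial>generalized_arcsine \<alpha>) = (1 - q) powr (\<alpha> - 1)"
    unfolding intv using series by (rule sums_unique2)
  moreover have "(\<integral>x. (\<Sum>k. (q * x) ^ k) \<partial>generalized_arcsine \<alpha>) = (\<integral>x. 1 / (1 - q * x) \<partial>generalized_arcsine \<alpha>)"
  proof (rule integral_cong_AE)
    show "AE x in generalized_arcsine \<alpha>. (\<Sum>k. (q * x) ^ k) = 1 / (1 - q * x)"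
      using AN
    proof eventually_elim
      case (elim x)
      then show ?case using lt[OF elim] by (intro suminf_geometric) auto
    qed
  qed measurable
  ultimately show ?thesis by simp
qed

lemma generalized_arcsine_no_atom:
  assumes "a \<noteq> 1"
  shows "emeasure (generalized_arcsine \<alpha>) {a} = 0"
proof (cases "\<alpha> = 0")
  case True then show ?thesis using assms by (simp add: generalized_arcsine_def)
next
  case False
  have "AE x in lborel. x \<noteq> a" by (rule AE_lborel_singleton)
  then show ?thesis using False
    by (auto simp: generalized_arcsine_def emeasure_density nn_integral_0_iff_AE elim!: eventually_mono)
qed

text \<open>
  On \<open>(1/2, 1)\<close> the integrand \<open>x powr (-\<alpha> - 1) * (1 - x) powr (\<alpha> - 1)\<close> has the
  antiderivative \<open>- ((1 - x) / x) powr \<alpha> / \<alpha>\<close>, which vanishes at 1.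
\<close>

lemma generalized_arcsine_test:
  assumes "0 \<le> \<alpha>" "\<alpha> < 1"
  shows "(\<integral>x. (if x > 1/2 then 1 / x else 0) \<partial>generalized_arcsine \<alpha>) = 1 / stieltjes_const \<alpha>"
proof (cases "\<alpha> = 0")
  case True then show ?thesis by (simp add: generalized_arcsine_def stieltjes_const_def integral_return)
next
  case False
  then have a: "0 < \<alpha>" using assms by simp
  define F where "F = (\<lambda>x::real. - (((1 - x) / x) powr \<alpha>) / \<alpha>)"
  define f where "f = (\<lambda>x::real. x powr (- \<alpha> - 1) * (1 - x) powr (\<alpha> - 1))"
  have FTC: "set_integrable lborel (einterval (ereal (1/2)) (ereal 1)) f"
    "interval_lebesgue_integral lborel (ereal (1/2)) (ereal 1) f = 0 - (- (1 / \<alpha>))"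
  proof -
    have 1: "DERIV F x :> f x" if "1/2 < x" "x < 1" for x
    proof -
      have "DERIV F x :> (- (\<alpha> * ((1 - x) / x) powr (\<alpha> - 1) * (- 1 / x\<^sup>2)) / \<alpha>)"
        unfolding F_def using that a
        by (auto intro!: derivative_eq_intros simp: field_simps power2_eq_square)
      also have "- (\<alpha> * ((1 - x) / x) powr (\<alpha> - 1) * (- 1 / x\<^sup>2)) / \<alpha> = ((1 - x) / x) powr (\<alpha> - 1) / x\<^sup>2"
        using a by (simp add: field_simps)
      also have "\<dots> = f x"
        using that by (simp add: f_def powr_divide powr_diff powr_minus field_simps power2_eq_square)
      finally show ?thesis .
    qed
    have 2: "isCont f x" if "1/2 < x" "x < 1" for x
      unfolding f_def using that by (auto intro!: continuous_intros)
    have 3: "((F \<circ> real_of_ereal) \<longlongrightarrow> - (1 / \<alpha>)) (at_right (ereal (1/2)))"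
    proof -
      have "((\<lambda>x. - (((1 - x) / x) powr \<alpha>) / \<alpha>) \<longlongrightarrow> - (((1 - 1/2) / (1/2)) powr \<alpha>) / \<alpha>) (at_right (1/2::real))"
        using a by (intro tendsto_intros) auto
      then show ?thesis unfolding ereal_tendsto_simps1 F_def by simp
    qed
    have 4: "((F \<circ> real_of_ereal) \<longlongrightarrow> 0) (at_left (ereal 1))"
    proof -
      have *: "((\<lambda>x. (1 - x) / x) \<longlongrightarrow> (1 - 1) / 1) (at_left (1::real))"
        by (intro tendsto_intros) auto
      have "\<forall>\<^sub>F x in at_left (1::real). 0 \<le> (1 - x) / x"
        using eventually_at_left_real[of 0 1] by (auto elim!: eventually_mono)
      then have "((\<lambda>x. ((1 - x) / x) powr \<alpha>) \<longlongrightarrow> 0) (at_left (1::real))"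
        using * a by (intro tendsto_zero_powrI[OF _ tendsto_const]) auto
      then have "((\<lambda>x. - (((1 - x) / x) powr \<alpha>) / \<alpha>) \<longlongrightarrow> - 0 / \<alpha>) (at_left (1::real))"
        using a by (intro tendsto_intros) auto
      then show ?thesis unfolding ereal_tendsto_simps1 F_def by simp
    qed
    show "set_integrable lborel (einterval (ereal (1/2)) (ereal 1)) f"
      "interval_lebesgue_integral lborel (ereal (1/2)) (ereal 1) f = 0 - (- (1 / \<alpha>))"
      by (rule interval_integral_FTC_nonneg[OF _ _ _ _ 3 4]; use 1 2 in \<open>auto simp: f_def\<close>)+
  qed
  have "has_bochner_integral lborel (\<lambda>x. indicator {1/2<..<1} x * f x) (1 / \<alpha>)"
    using FTC by (auto simp: has_bochner_integral_iff interval_lebesgue_integral_def set_integrable_def set_lebesgue_integral_def)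
  also have "(\<lambda>x. indicator {1/2<..<1} x * f x) =
      (\<lambda>x. indicator {0<..<1} x * (x powr (- \<alpha>) * (1 - x) powr (\<alpha> - 1) * (if x > 1/2 then 1 / x else 0)))"
    by (auto simp: fun_eq_iff indicator_def f_def powr_diff)
  finally have "has_bochner_integral (generalized_arcsine \<alpha>) (\<lambda>x. if x > 1/2 then 1 / x else 0) ((1 / \<alpha>) / Beta (1 - \<alpha>) \<alpha>)"
    by (intro integral_generalized_arcsine a assms) auto
  then show ?thesis using False Beta_complement(1)[OF a assms(2)]
    by (simp add: has_bochner_integral_iff stieltjes_const_def mult.commute)
qed

lemma stieltjes_const_pos:
  assumes "0 \<le> \<alpha>" "\<alpha> < 1"
  shows "stieltjes_const \<alpha> > 0"
  using assms sin_gt_zero[of "pi * \<alpha>"] by (auto simp: stieltjes_const_def)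

section \<open>The Karamata theorem for the Stieltjes transform\<close>

text \<open>
  The asymptotic form \<open>c * x powr p * L x\<close> enters the Abelian and the Tauberian theorem only
  through this limit and through the eventual positivity that it also entails.
\<close>

lemma regularly_varying_ratio:
  fixes f :: "real \<Rightarrow> real"
  assumes L: "slowly_varying L" and c: "c \<noteq> 0" and b: "b > 0"
    and f: "f \<sim>[at_top] (\<lambda>x. c * x powr p * L x)"
  shows "((\<lambda>x. f (b * x) / f x) \<longlongrightarrow> b powr p) at_top"
proof -
  let ?R = "\<lambda>x. c * x powr p * L x"
  have b_top: "filterlim (\<lambda>x. b * x) at_top at_top"
    by (rule filterlim_tendsto_pos_mult_at_top[OF tendsto_const b filterlim_ident])
  have "(\<lambda>x. f (b * x)) \<sim>[at_top] (\<lambda>x. ?R (b * x))"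
    by (rule asymp_equiv_compose'[OF f b_top])
  then have "(\<lambda>x. f (b * x) / f x) \<sim>[at_top] (\<lambda>x. ?R (b * x) / ?R x)"
    by (rule asymp_equiv_divide[OF _ f])
  moreover have "((\<lambda>x. ?R (b * x) / ?R x) \<longlongrightarrow> b powr p) at_top"
  proof -
    have "((\<lambda>x. b powr p * (L (b * x) / L x)) \<longlongrightarrow> b powr p * 1) at_top"
      by (intro tendsto_intros slowly_varying_scale L b)
    moreover have "\<forall>\<^sub>F x in at_top. b powr p * (L (b * x) / L x) = ?R (b * x) / ?R x"
      using eventually_gt_at_top[of 0]
      by eventually_elim (use c b in \<open>simp add: powr_mult\<close>)
    ultimately show ?thesis by (simp add: filterlim_cong)
  qed
  ultimately show ?thesis by (rule tendsto_asymp_equiv_cong[THEN iffD2])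
qed

lemma regularly_varying_eventually_pos:
  fixes f :: "real \<Rightarrow> real"
  assumes L: "slowly_varying L" and c: "c > 0"
    and f: "f \<sim>[at_top] (\<lambda>x. c * x powr p * L x)"
  shows "\<forall>\<^sub>F x in at_top. f x > 0"
proof -
  have "\<forall>\<^sub>F x in at_top. sgn (f x) = sgn (c * x powr p * L x)"
    by (rule asymp_equiv_eventually_same_sign[OF f])
  then show ?thesis using slowly_varying_eventually_pos[OF L] eventually_gt_at_top[of 0]
  proof eventually_elim
    case (elim x)
    then have "sgn (f x) = 1" using c by (simp add: sgn_mult)
    then show ?case by (simp add: sgn_1_pos)
  qed
qed

text \<open>
  The Stieltjes kernel \<open>1 / (s + t)\<close>, multiplied by \<open>s\<close>. In this normalization its values lie in
  the unit interval, and infinity is sent to 0.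
\<close>

definition stieltjes_weight :: "real \<Rightarrow> ennreal \<Rightarrow> real" where
  "stieltjes_weight s t = (if t = \<infinity> then 0 else s / (s + enn2real t))"

lemma stieltjes_weight_measurable [measurable]: "stieltjes_weight s \<in> borel_measurable borel"
proof -
  have [measurable]: "{t::ennreal. t = \<infinity>} \<in> sets borel" by simp
  show ?thesis unfolding stieltjes_weight_def by measurable
qed

lemma stieltjes_weight_bounds:
  assumes "s > 0"
  shows "0 \<le> stieltjes_weight s t" "stieltjes_weight s t \<le> 1"
  using assms by (auto simp: stieltjes_weight_def divide_le_eq_1 add_pos_nonneg)

lemma stieltjes_weight_gt_iff:
  assumes "s > 0" "0 < w" "w < 1"
  shows "w < stieltjes_weight s t \<longleftrightarrow> t < ennreal (s * ((1 - w) / w))"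
proof (cases t)
  case (real r)
  have "w < s / (s + r) \<longleftrightarrow> w * (s + r) < s"
    using assms real by (simp add: less_divide_eq add_pos_nonneg)
  also have "\<dots> \<longleftrightarrow> r < s * ((1 - w) / w)" using assms by (simp add: field_simps)
  finally show ?thesis using real assms by (simp add: stieltjes_weight_def ennreal_less_iff)
next
  case top
  then show ?thesis using assms by (simp add: stieltjes_weight_def)
qed

text \<open>
  In terms of the weight \<open>w\<close> at scale \<open>s\<close>, a change of scale is the map
  \<open>w / (1 - q w)\<close>. This is why geometric transforms appear.
\<close>

lemma stieltjes_weight_rescale:
  assumes "s > 0" "q \<in> {0<..<1}"
  shows "stieltjes_weight s t / (1 - q * stieltjes_weight s t) = stieltjes_weight ((1 - q) * s) t / (1 - q)"
proof (cases "t = \<infinity>")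
  case False
  define r where "r = enn2real t"
  have r: "r \<ge> 0" by (simp add: r_def)
  have "s + r > 0" "(1 - q) * s + r > 0" using assms r by (auto intro!: add_pos_nonneg)
  moreover have "1 - q * (s / (s + r)) = ((1 - q) * s + r) / (s + r)"
    using \<open>s + r > 0\<close> by (simp add: field_simps)
  ultimately show ?thesis using False assms by (simp add: stieltjes_weight_def flip: r_def)
qed (simp add: stieltjes_weight_def)

lemma mono_initial_mass:
  assumes "finite_measure \<sigma>" "sets \<sigma> = sets borel"
  shows "mono (\<lambda>x. measure \<sigma> {0..<ennreal x})"
proof -
  interpret finite_measure \<sigma> by fact
  show ?thesis
    by (intro monoI finite_measure_mono) (auto simp: assms(2) intro: less_le_trans ennreal_leI)
qed

text \<open>
  The weight exceeds the level \<open>w\<close> exactly on an initial interval of the half-line, so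
  integrating over levels expresses the Stieltjes transform through the masses of initial
  intervals.
\<close>

lemma stieltjes_layer_cake:
  fixes \<sigma> :: "ennreal measure"
  assumes fin: "finite_measure \<sigma>" and S: "sets \<sigma> = sets borel" and s: "s > 0"
  shows "(\<integral>t. stieltjes_weight s t \<partial>\<sigma>) =
    (\<integral>w. indicator {0<..<1} w * measure \<sigma> {0..<ennreal (s * ((1 - w) / w))} \<partial>lborel)"
proof -
  interpret finite_measure \<sigma> by fact
  interpret pair_sigma_finite \<sigma> "lborel :: real measure" ..
  define F where "F = (\<lambda>x. measure \<sigma> {0..<ennreal x})"
  have Fm[measurable]: "F \<in> borel_measurable borel"
    unfolding F_def by (rule borel_measurable_mono[OF mono_initial_mass[OF fin S]])
  have [measurable]: "stieltjes_weight s \<in> borel_measurable \<sigma>"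
    using stieltjes_weight_measurable by (simp add: measurable_cong_sets[OF S refl])
  define J where "J = (\<lambda>t w. if 0 < w \<and> w < 1 \<and> w < stieltjes_weight s t then 1 else 0 :: ennreal)"
  have [measurable]: "(\<lambda>(t, w). J t w) \<in> borel_measurable (\<sigma> \<Otimes>\<^sub>M lborel)"
    unfolding J_def by measurable
  have inner: "ennreal (stieltjes_weight s t) = (\<integral>\<^sup>+w. J t w \<partial>lborel)" for t
  proof -
    have "J t w = indicator {0<..<stieltjes_weight s t} w" for w
      using stieltjes_weight_bounds[OF s, of t] by (auto simp: indicator_def J_def)
    then have "(\<integral>\<^sup>+w. J t w \<partial>lborel) = (\<integral>\<^sup>+w. indicator {0<..<stieltjes_weight s t} w \<partial>lborel)"
      by simp
    also have "\<dots> = ennreal (stieltjes_weight s t)"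
      using stieltjes_weight_bounds[OF s, of t] by simp
    finally show ?thesis by simp
  qed
  have level: "(\<integral>\<^sup>+t. J t w \<partial>\<sigma>) = ennreal (indicator {0<..<1} w * F (s * ((1 - w) / w)))" for w
  proof (cases "w \<in> {0<..<1}")
    case True
    then have "J t w = indicator {0..<ennreal (s * ((1 - w) / w))} t" for t
      using stieltjes_weight_gt_iff[OF s, of w t] by (auto simp: J_def indicator_def)
    then show ?thesis using True S by (simp add: F_def emeasure_eq_measure)
  qed (auto simp: J_def)
  have "(\<integral>\<^sup>+t. ennreal (stieltjes_weight s t) \<partial>\<sigma>) = (\<integral>\<^sup>+t. (\<integral>\<^sup>+w. J t w \<partial>lborel) \<partial>\<sigma>)"
    by (simp only: inner)
  also have "\<dots> = (\<integral>\<^sup>+w. (\<integral>\<^sup>+t. J t w \<partial>\<sigma>) \<partial>lborel)"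
    by (rule Fubini'[symmetric]) measurable
  also have "\<dots> = (\<integral>\<^sup>+w. ennreal (indicator {0<..<1} w * F (s * ((1 - w) / w))) \<partial>lborel)"
    by (simp only: level)
  finally have eq: "(\<integral>\<^sup>+t. ennreal (stieltjes_weight s t) \<partial>\<sigma>) =
     (\<integral>\<^sup>+w. ennreal (indicator {0<..<1} w * F (s * ((1 - w) / w))) \<partial>lborel)" .
  have "(\<integral>t. stieltjes_weight s t \<partial>\<sigma>) = enn2real (\<integral>\<^sup>+t. ennreal (stieltjes_weight s t) \<partial>\<sigma>)"
    by (rule integral_eq_nn_integral) (use stieltjes_weight_bounds[OF s] in auto)
  also have "\<dots> = (\<integral>w. indicator {0<..<1} w * F (s * ((1 - w) / w)) \<partial>lborel)"
    unfolding eq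
  proof (rule integral_eq_nn_integral[symmetric])
    show "(\<lambda>w. indicator {0<..<1} w * F (s * ((1 - w) / w))) \<in> borel_measurable lborel" by measurable
  qed (simp add: F_def)
  finally show ?thesis unfolding F_def .
qed

text \<open>
  Iterated doubling bounds \<open>F (s u) / F s\<close> by a multiple of \<open>u powr b\<close> as long as \<open>s u\<close> stays
  below \<open>s0\<close>. Beyond \<open>s0\<close> the total bound \<open>m\<close> is compared with \<open>F s0\<close>.
\<close>

lemma potter_bound_monotone:
  fixes F :: "real \<Rightarrow> real"
  assumes mono: "mono F" and m: "\<And>x. F x \<le> m" and b: "b \<ge> 0" and s0: "s0 > 0"
    and pos: "\<And>s. 0 < s \<Longrightarrow> s \<le> s0 \<Longrightarrow> F s > 0"
    and doubling: "\<And>s. 0 < s \<Longrightarrow> s \<le> s0 \<Longrightarrow> F (2 * s) \<le> 2 powr b * F s"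
  obtains C where "\<And>s u. 0 < s \<Longrightarrow> s \<le> s0 \<Longrightarrow> 0 < u \<Longrightarrow> F (s * u) \<le> C * (max 1 (u powr b) * F s)"
proof -
  have iter: "F (2 ^ n * s) \<le> (2 powr b) ^ n * F s" if "s > 0" "n > 0 \<Longrightarrow> 2 ^ (n - 1) * s \<le> s0" for n s
    using that
  proof (induction n)
    case (Suc n)
    have le: "2 ^ n * s \<le> s0" using Suc.prems by simp
    have "2 ^ (n - 1) * s \<le> 2 ^ n * s" using Suc.prems by (intro mult_right_mono power_increasing) auto
    then have "2 ^ (n - 1) * s \<le> s0" using le by linarith
    then have "F (2 ^ n * s) \<le> (2 powr b) ^ n * F s" by (rule Suc.IH[OF Suc.prems(1)])
    then have "2 powr b * F (2 ^ n * s) \<le> 2 powr b * ((2 powr b) ^ n * F s)" by (intro mult_left_mono) auto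
    moreover have "F (2 * (2 ^ n * s)) \<le> 2 powr b * F (2 ^ n * s)"
      by (rule doubling) (use le Suc.prems in auto)
    ultimately have "F (2 * (2 ^ n * s)) \<le> 2 powr b * ((2 powr b) ^ n * F s)" by linarith
    then show ?case by (simp add: mult.assoc)
  qed simp
  have near: "F (s * u) \<le> 2 powr b * (u powr b * F s)" if s: "0 < s" "s \<le> s0" and u: "1 \<le> u" "s * u \<le> s0" for s u
  proof -
    define n where "n = nat \<lceil>log 2 u\<rceil>"
    have lg: "log 2 u \<ge> 0" using u by simp
    have n: "log 2 u \<le> real n" "real n < log 2 u + 1" unfolding n_def using lg by linarith+
    have un: "u \<le> 2 ^ n" using n(1) u by (simp add: log_le_iff powr_realpow)
    have n2: "2 ^ (n - 1) * s \<le> s0" if "n > 0"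
    proof -
      have "real (n - 1) < log 2 u" using n(2) that by linarith
      then have "2 powr real (n - 1) < u" using u by (simp add: less_log_iff)
      then have "2 ^ (n - 1) < u" by (simp add: powr_realpow)
      then have "2 ^ (n - 1) * s \<le> u * s" using s by (intro mult_right_mono) auto
      then show ?thesis using u by (simp add: mult.commute)
    qed
    have "F (s * u) \<le> F (2 ^ n * s)" using un s by (intro monoD[OF mono]) (simp add: mult.commute)
    also have "\<dots> \<le> (2 powr b) ^ n * F s" by (rule iter[OF s(1) n2])
    also have "\<dots> \<le> (2 powr b * u powr b) * F s"
    proof (rule mult_right_mono)
      have "(2 powr b) ^ n = (2 powr real n) powr b" by (simp add: powr_power powr_powr mult.commute)
      also have "\<dots> \<le> (2 powr (log 2 u + 1)) powr b" using n(2) b by (intro powr_mono2) auto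
      also have "\<dots> = 2 powr b * u powr b" using u by (simp add: powr_add powr_mult)
      finally show "(2 powr b) ^ n \<le> 2 powr b * u powr b" .
    qed (use pos[OF s] in simp)
    finally show ?thesis by (simp add: mult.assoc)
  qed
  have F0: "F s0 > 0" using pos s0 by simp
  define D where "D = max 1 (m / F s0)"
  have b2: "2 powr b \<ge> 1" using b by (simp add: ge_one_powr_ge_zero)
  show ?thesis
  proof (rule that[of "2 powr b * D"])
    fix s u :: real assume s: "0 < s" "s \<le> s0" and u: "0 < u"
    have Fs: "F s > 0" by (rule pos[OF s])
    have "F (s * u) \<le> D * (2 powr b * (max 1 (u powr b) * F s))"
    proof (cases "u \<le> 1")
      case True
      have "F (s * u) \<le> F s" using True s by (intro monoD[OF mono]) (simp add: mult_left_le)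
      also have "\<dots> = 1 * (1 * (1 * F s))" by simp
      also have "\<dots> \<le> D * (2 powr b * (max 1 (u powr b) * F s))"
        using b2 Fs by (intro mult_mono) (auto simp: D_def)
      finally show ?thesis .
    next
      case False
      then have u1: "u \<ge> 1" by simp
      have le_max: "2 powr b * (u powr b * F s) \<le> 2 powr b * (max 1 (u powr b) * F s)"
        using Fs by (intro mult_left_mono mult_right_mono) auto
      show ?thesis
      proof (cases "s * u \<le> s0")
        case True
        have "F (s * u) \<le> 1 * (2 powr b * (max 1 (u powr b) * F s))"
          using order_trans[OF near[OF s u1 True] le_max] by simp
        also have "\<dots> \<le> D * (2 powr b * (max 1 (u powr b) * F s))"
          using b2 Fs by (intro mult_right_mono) (auto simp: D_def intro!: mult_nonneg_nonneg)
        finally show ?thesis .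
      next
        case False
        have "s0 / s \<le> u" "1 \<le> s0 / s" using False s by (auto simp: field_simps)
        have "F s0 = F (s * (s0 / s))" using s by simp
        also have "\<dots> \<le> 2 powr b * ((s0 / s) powr b * F s)"
          by (rule near[OF s \<open>1 \<le> s0 / s\<close>]) (use s in simp)
        also have "\<dots> \<le> 2 powr b * (u powr b * F s)"
          using \<open>s0 / s \<le> u\<close> s Fs b s0 by (intro mult_left_mono mult_right_mono powr_mono2) auto
        finally have "F s0 \<le> 2 powr b * (u powr b * F s)" .
        from order_trans[OF this le_max] have 1: "F s0 \<le> 2 powr b * (max 1 (u powr b) * F s)" .
        have "F (s * u) \<le> (m / F s0) * F s0" using m[of "s * u"] F0 by simp
        also have "\<dots> \<le> D * F s0" using F0 by (intro mult_right_mono) (auto simp: D_def)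
        also have "\<dots> \<le> D * (2 powr b * (max 1 (u powr b) * F s))"
          using 1 by (intro mult_left_mono) (auto simp: D_def)
        finally show ?thesis .
      qed
    qed
    then show "F (s * u) \<le> 2 powr b * D * (max 1 (u powr b) * F s)" by (simp add: mult_ac)
  qed
qed


text \<open>
  By the layer cake formula the quotient is \<open>\<integral>\<^sub>0\<^sup>1 f (s (1 - w) / w) / f s dw\<close>
  with \<open>s = 1 / x\<close>. The integrand converges to \<open>((1 - w) / w) powr \<alpha>\<close>. The doubling bound with an
  exponent \<open>b\<close> strictly between \<open>\<alpha>\<close> and 1 provides an integrable majorant.
\<close>

theorem stieltjes_abelian:
  fixes \<sigma> :: "ennreal measure"
  assumes a: "0 \<le> \<alpha>" "\<alpha> < 1" and L: "slowly_varying L"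
    and fin: "finite_measure \<sigma>" and S: "sets \<sigma> = sets borel"
    and F: "(\<lambda>x. measure \<sigma> {0..<ennreal (1 / x)}) \<sim>[at_top] (\<lambda>x. 1 * x powr (- \<alpha>) * L x)"
  shows "((\<lambda>x. (\<integral>t. stieltjes_weight (1 / x) t \<partial>\<sigma>) / measure \<sigma> {0..<ennreal (1 / x)})
           \<longlongrightarrow> stieltjes_const \<alpha>) at_top"
proof -
  interpret finite_measure \<sigma> by fact
  define f where "f = (\<lambda>x. measure \<sigma> {0..<ennreal x})"
  have mono: "mono f" unfolding f_def by (rule mono_initial_mass[OF fin S])
  have [measurable]: "f \<in> borel_measurable borel" by (rule borel_measurable_mono[OF mono])
  have f0: "f x \<ge> 0" for x by (simp add: f_def)
  have pos: "\<forall>\<^sub>F x in at_top. f (1 / x) > 0"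
    unfolding f_def by (rule regularly_varying_eventually_pos[OF L _ F]) simp
  have ratio: "((\<lambda>x. f (u / x) / f (1 / x)) \<longlongrightarrow> u powr \<alpha>) at_top" if u: "u > 0" for u
    using regularly_varying_ratio[OF L _ _ F, of "1 / u"] u
    by (simp add: f_def powr_divide powr_minus)
  \<comment> \<open>any exponent strictly between \<open>\<alpha>\<close> and 1 serves: it makes doubling strict and \<open>w powr (- b)\<close> integrable at 0\<close>
  define b where "b = (1 + \<alpha>) / 2"
  have b: "\<alpha> < b" "b < 1" "b > 0" using a by (auto simp: b_def)
  obtain X where X: "X > 0" "\<And>x. x \<ge> X \<Longrightarrow> f (1 / x) > 0" "\<And>x. x \<ge> X \<Longrightarrow> f (2 / x) < 2 powr b * f (1 / x)"
  proof -
    have "\<forall>\<^sub>F x in at_top. f (2 / x) / f (1 / x) < 2 powr b"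
      by (rule order_tendstoD(2)[OF ratio]) (use b in auto)
    with pos have "\<forall>\<^sub>F x in at_top. x > 0 \<and> f (1 / x) > 0 \<and> f (2 / x) < 2 powr b * f (1 / x)"
      using eventually_gt_at_top[of 0] by eventually_elim (simp add: pos_divide_less_eq)
    then show ?thesis using that unfolding eventually_at_top_linorder by (metis order_refl)
  qed
  obtain C where C: "\<And>s u. 0 < s \<Longrightarrow> s \<le> 1 / X \<Longrightarrow> 0 < u \<Longrightarrow> f (s * u) \<le> C * (max 1 (u powr b) * f s)"
  proof (rule potter_bound_monotone[OF mono, of "measure \<sigma> (space \<sigma>)" b "1 / X"])
    show "f x \<le> measure \<sigma> (space \<sigma>)" for x unfolding f_def by (rule bounded_measure)
    show "f s > 0" if "0 < s" "s \<le> 1 / X" for s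
      using X(2)[of "1 / s"] X(1) that by (simp add: field_simps)
    show "f (2 * s) \<le> 2 powr b * f s" if "0 < s" "s \<le> 1 / X" for s
      using X(3)[of "1 / s"] X(1) that by (simp add: field_simps)
  qed (use b X in auto)
  define I where "I = (\<lambda>x w. indicator {0<..<1} w * f (1 / x * ((1 - w) / w)) / f (1 / x))"
  have "((\<lambda>x. \<integral>w. I x w \<partial>lborel) \<longlongrightarrow>
      (\<integral>w. indicator {0<..<1} w * (w powr ((1 - \<alpha>) - 1) * (1 - w) powr ((1 + \<alpha>) - 1)) \<partial>lborel)) at_top"
  proof (rule integral_dominated_convergence_at_top)
    show "I x \<in> borel_measurable lborel" for x unfolding I_def by measurable
    show "AE w in lborel. ((\<lambda>x. I x w) \<longlongrightarrow>
        indicator {0<..<1} w * (w powr ((1 - \<alpha>) - 1) * (1 - w) powr ((1 + \<alpha>) - 1))) at_top"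
    proof (rule AE_I2)
      fix w :: real
      show "((\<lambda>x. I x w) \<longlongrightarrow> indicator {0<..<1} w * (w powr ((1 - \<alpha>) - 1) * (1 - w) powr ((1 + \<alpha>) - 1))) at_top"
      proof (cases "w \<in> {0<..<1}")
        case True
        have "((1 - w) / w) powr \<alpha> = w powr ((1 - \<alpha>) - 1) * (1 - w) powr ((1 + \<alpha>) - 1)"
          using True by (simp add: powr_divide powr_minus field_simps)
        moreover have "I x w = f ((1 - w) / w / x) / f (1 / x)" for x using True by (simp add: I_def mult.commute)
        ultimately show ?thesis using ratio[of "(1 - w) / w"] True by simp
      qed (simp add: I_def)
    qed
    show "\<forall>\<^sub>F x in at_top. AE w in lborel. norm (I x w) \<le> \<bar>C\<bar> * (indicator {0<..<1} w + indicator {0<..<1} w * (w powr ((1 - b) - 1) * (1 - w) powr (1 - 1)))"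
      using eventually_ge_at_top[of X]
    proof eventually_elim
      case (elim x)
      have x: "x > 0" "1 / x \<le> 1 / X" using elim X by (auto simp: field_simps)
      have "norm (I x w) \<le> \<bar>C\<bar> * (indicator {0<..<1} w + indicator {0<..<1} w * (w powr ((1 - b) - 1) * (1 - w) powr (1 - 1)))" for w
      proof (cases "w \<in> {0<..<1}")
        case True
        define u where "u = (1 - w) / w"
        have u: "u > 0" "u \<le> 1 / w" using True by (auto simp: u_def field_simps)
        have "f (1 / x * u) \<le> C * (max 1 (u powr b) * f (1 / x))"
          by (rule C) (use x u in auto)
        then have "f (1 / x * u) / f (1 / x) \<le> C * max 1 (u powr b)"
          using X(2)[OF elim] by (simp add: divide_le_eq mult.assoc)
        also have "\<dots> \<le> \<bar>C\<bar> * (1 + w powr (- b))"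
        proof (rule mult_mono)
          have "u powr b \<le> (1 / w) powr b" using u b by (intro powr_mono2) auto
          also have "\<dots> = w powr (- b)" using True by (simp add: powr_divide powr_minus_divide)
          finally show "max 1 (u powr b) \<le> 1 + w powr (- b)" using powr_ge_zero[of w "-b"] by linarith
        qed auto
        finally have "f (1 / x * u) / f (1 / x) \<le> \<bar>C\<bar> * (1 + w powr (- b))" .
        moreover have "norm (I x w) = f (1 / x * u) / f (1 / x)"
          using True f0 by (simp add: I_def u_def)
        ultimately show ?thesis using True by simp
      qed (simp add: I_def)
      then show ?case by simp
    qed
    have "integrable lborel (\<lambda>w. indicator {0<..<1} w * (w powr ((1 - b) - 1) * (1 - w) powr (1 - 1)))"
      using Beta_integral[of "1 - b" 1] b by (auto simp: has_bochner_integral_iff)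
    then show "integrable lborel (\<lambda>w. \<bar>C\<bar> * (indicator {0<..<1} w + indicator {0<..<1} w * (w powr ((1 - b) - 1) * (1 - w) powr (1 - 1))))"
      by (intro integrable_mult_right Bochner_Integration.integrable_add) auto
  qed measurable
  moreover have "(\<integral>w. indicator {0<..<1} w * (w powr ((1 - \<alpha>) - 1) * (1 - w) powr ((1 + \<alpha>) - 1)) \<partial>lborel) = stieltjes_const \<alpha>"
    using Beta_integral[of "1 - \<alpha>" "1 + \<alpha>"] a stieltjes_const_Beta[OF a]
    by (simp add: has_bochner_integral_iff Beta_commute)
  moreover have "\<forall>\<^sub>F x in at_top. (\<integral>w. I x w \<partial>lborel) = (\<integral>t. stieltjes_weight (1 / x) t \<partial>\<sigma>) / f (1 / x)"
    using eventually_gt_at_top[of 0]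
  proof eventually_elim
    case (elim x)
    then show ?case using stieltjes_layer_cake[OF fin S, of "1 / x"]
      unfolding I_def f_def by simp
  qed
  ultimately show ?thesis unfolding f_def by (simp add: filterlim_cong)
qed

text \<open>
  Weighting the measure by \<open>stieltjes_weight s\<close>, normalizing, and pushing forward along that same
  function gives a law on the unit interval that encodes the measure seen at scale \<open>s\<close>.
\<close>

lemma size_biased_weight_law:
  fixes \<sigma> :: "ennreal measure"
  assumes fin: "finite_measure \<sigma>" and S: "sets \<sigma> = sets borel" and s: "s > 0"
    and K: "(\<integral>t. stieltjes_weight s t \<partial>\<sigma>) > 0" (is "?K > 0")
  defines "\<rho> \<equiv> distr (density \<sigma> (\<lambda>t. ennreal (stieltjes_weight s t / (\<integral>t. stieltjes_weight s t \<partial>\<sigma>)))) borel (stieltjes_weight s)"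
  shows "real_distribution \<rho>"
    and "AE x in \<rho>. x \<in> {0..1}"
    and "\<And>\<phi>. \<phi> \<in> borel_measurable borel \<Longrightarrow>
      (\<integral>x. \<phi> x \<partial>\<rho>) = (\<integral>t. stieltjes_weight s t * \<phi> (stieltjes_weight s t) \<partial>\<sigma>) / (\<integral>t. stieltjes_weight s t \<partial>\<sigma>)"
proof -
  interpret finite_measure \<sigma> by fact
  have [measurable]: "stieltjes_weight s \<in> borel_measurable \<sigma>"
    using stieltjes_weight_measurable by (simp add: measurable_cong_sets[OF S refl])
  note w = stieltjes_weight_bounds[OF s]
  have int: "integrable \<sigma> (stieltjes_weight s)"
    by (rule integrable_const_bound[where B = 1]) (use w in auto)
  define D where "D = density \<sigma> (\<lambda>t. ennreal (stieltjes_weight s t / ?K))"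
  have D[measurable]: "stieltjes_weight s \<in> borel_measurable D"
    unfolding D_def by simp
  have rho: "\<rho> = distr D borel (stieltjes_weight s)" by (simp add: \<rho>_def D_def)
  have "(\<integral>\<^sup>+t. ennreal (stieltjes_weight s t / ?K) \<partial>\<sigma>) = ennreal (\<integral>t. stieltjes_weight s t / ?K \<partial>\<sigma>)"
    by (rule nn_integral_eq_integral) (use int w K in \<open>auto intro!: divide_nonneg_pos\<close>)
  also have "(\<integral>t. stieltjes_weight s t / ?K \<partial>\<sigma>) = 1" using K by simp
  finally have "emeasure D (space D) = 1"
    unfolding D_def by (subst emeasure_density) (auto simp: indicator_def cong: nn_integral_cong)
  then have "prob_space D" by (rule prob_spaceI)
  then have "prob_space \<rho>" unfolding rho by (rule prob_space.prob_space_distr) simp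
  then show "real_distribution \<rho>"
    by (simp add: real_distribution_def real_distribution_axioms_def rho)
  show "AE x in \<rho>. x \<in> {0..1}"
    unfolding rho by (subst AE_distr_iff) (use w in auto)
  fix \<phi> :: "real \<Rightarrow> real" assume [measurable]: "\<phi> \<in> borel_measurable borel"
  have "(\<integral>x. \<phi> x \<partial>\<rho>) = (\<integral>t. \<phi> (stieltjes_weight s t) \<partial>D)"
    unfolding rho by (rule integral_distr) auto
  also have "\<dots> = (\<integral>t. (stieltjes_weight s t / ?K) *\<^sub>R \<phi> (stieltjes_weight s t) \<partial>\<sigma>)"
    unfolding D_def by (rule integral_density) (use w K in \<open>auto intro!: divide_nonneg_pos\<close>)
  also have "\<dots> = (\<integral>t. stieltjes_weight s t * \<phi> (stieltjes_weight s t) / ?K \<partial>\<sigma>)"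
    by (intro Bochner_Integration.integral_cong) auto
  finally show "(\<integral>x. \<phi> x \<partial>\<rho>) = (\<integral>t. stieltjes_weight s t * \<phi> (stieltjes_weight s t) \<partial>\<sigma>) / ?K"
    by simp
qed

text \<open>
  The laws \<open>\<rho> n\<close> of the weight have geometric transforms
  \<open>K ((1 - q) s) / ((1 - q) * K s)\<close>, where \<open>K s\<close> is the integral of the weight at scale \<open>s\<close>.
  Regular variation of \<open>K\<close> makes them converge to
  \<open>(1 - q) powr (\<alpha> - 1)\<close>, so the laws converge weakly to the generalized arcsine law. The mass
  of an initial interval is \<open>K s\<close> times the integral of \<open>1 / x\<close> over \<open>x > 1/2\<close>, a test
  function that is discontinuous only at the point 1/2, which carries no mass in the limit.
\<close>

theorem stieltjes_tauberian:
  fixes \<sigma> :: "ennreal measure"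
  assumes a: "0 \<le> \<alpha>" "\<alpha> < 1" and L: "slowly_varying L"
    and fin: "finite_measure \<sigma>" and S: "sets \<sigma> = sets borel" and c: "c > 0"
    and K: "(\<lambda>x. \<integral>t. stieltjes_weight (1 / x) t \<partial>\<sigma>) \<sim>[at_top] (\<lambda>x. c * x powr (- \<alpha>) * L x)"
  shows "((\<lambda>x. measure \<sigma> {0..<ennreal (1 / x)} / (\<integral>t. stieltjes_weight (1 / x) t \<partial>\<sigma>))
           \<longlongrightarrow> 1 / stieltjes_const \<alpha>) at_top"
proof (rule tendsto_at_topI_sequentially)
  interpret finite_measure \<sigma> by fact
  define k where "k = (\<lambda>s. \<integral>t. stieltjes_weight s t \<partial>\<sigma>)"
  fix X :: "nat \<Rightarrow> real" assume X: "filterlim X at_top sequentially"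
  have "\<forall>\<^sub>F x in at_top. k (1 / x) > 0"
    unfolding k_def by (rule regularly_varying_eventually_pos[OF L c K])
  then have "\<forall>\<^sub>F x in at_top. x > 0 \<and> k (1 / x) > 0" using eventually_gt_at_top[of 0] by eventually_elim simp
  from eventually_compose_filterlim[OF this X]
  \<comment> \<open>the sequence is shifted by \<open>N\<close> so that every normalizing constant is positive\<close>
  obtain N where N: "\<And>n. n \<ge> N \<Longrightarrow> X n > 0 \<and> k (1 / X n) > 0"
    unfolding eventually_sequentially by auto
  define s where "s = (\<lambda>n. 1 / X (n + N))"
  have s: "s n > 0" "k (s n) > 0" for n using N[of "n + N"] by (auto simp: s_def)
  have XN: "filterlim (\<lambda>n. X (n + N)) at_top sequentially"
    using X by (rule filterlim_compose[OF _ filterlim_add_const_nat_at_top])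
  define \<rho> where "\<rho> = (\<lambda>n. distr (density \<sigma> (\<lambda>t. ennreal (stieltjes_weight (s n) t / k (s n)))) borel (stieltjes_weight (s n)))"
  have \<rho>: "real_distribution (\<rho> n)" "AE x in \<rho> n. x \<in> {0..1}"
    and int: "\<And>\<phi>. \<phi> \<in> borel_measurable borel \<Longrightarrow>
      (\<integral>x. \<phi> x \<partial>\<rho> n) = (\<integral>t. stieltjes_weight (s n) t * \<phi> (stieltjes_weight (s n) t) \<partial>\<sigma>) / k (s n)" for n
    using size_biased_weight_law[OF fin S s(1)[of n]] s(2)[of n] unfolding \<rho>_def k_def by blast+
  note N' = real_distribution_generalized_arcsine[OF a] AE_generalized_arcsine[OF a]
  have weak: "weak_conv_m \<rho> (generalized_arcsine \<alpha>)"
  proof (rule weak_conv_of_geometric_transforms[OF \<rho>(1) N'(1) \<rho>(2) N'(2)])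
    fix q :: real assume q: "q \<in> {0<..<1}"
    have val: "(\<integral>x. 1 / (1 - q * x) \<partial>\<rho> n) = k ((1 - q) * s n) / k (s n) / (1 - q)" for n
    proof -
      have "(\<integral>x. 1 / (1 - q * x) \<partial>\<rho> n) =
          (\<integral>t. stieltjes_weight (s n) t * (1 / (1 - q * stieltjes_weight (s n) t)) \<partial>\<sigma>) / k (s n)"
        by (rule int) measurable
      also have "(\<lambda>t. stieltjes_weight (s n) t * (1 / (1 - q * stieltjes_weight (s n) t))) =
          (\<lambda>t. stieltjes_weight ((1 - q) * s n) t / (1 - q))"
        using stieltjes_weight_rescale[OF s(1) q] by simp
      finally show ?thesis by (simp add: k_def)
    qed
    have "((\<lambda>x. k (1 / (1 / (1 - q) * x)) / k (1 / x)) \<longlongrightarrow> (1 / (1 - q)) powr (- \<alpha>)) at_top"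
      unfolding k_def by (rule regularly_varying_ratio[OF L _ _ K]) (use q c in auto)
    then have "((\<lambda>x. k ((1 - q) / x) / k (1 / x)) \<longlongrightarrow> (1 - q) powr \<alpha>) at_top"
      using q by (simp add: powr_divide powr_minus)
    from filterlim_compose[OF this XN]
    have "(\<lambda>n. k ((1 - q) * s n) / k (s n)) \<longlonglongrightarrow> (1 - q) powr \<alpha>" by (simp add: s_def)
    then have "(\<lambda>n. k ((1 - q) * s n) / k (s n) / (1 - q)) \<longlonglongrightarrow> (1 - q) powr \<alpha> / (1 - q)"
      using q by (intro tendsto_intros) auto
    then show "(\<lambda>n. \<integral>x. 1 / (1 - q * x) \<partial>\<rho> n) \<longlonglongrightarrow> (\<integral>x. 1 / (1 - q * x) \<partial>generalized_arcsine \<alpha>)"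
      unfolding val generalized_arcsine_geometric[OF a q] using q by (simp add: powr_diff)
  qed
  define g where "g = (\<lambda>x::real. if x > 1/2 then 1 / x else 0)"
  have [measurable]: "g \<in> borel_measurable borel" unfolding g_def by measurable
  have "(\<lambda>n. \<integral>x. g x \<partial>\<rho> n) \<longlonglongrightarrow> (\<integral>x. g x \<partial>generalized_arcsine \<alpha>)"
  proof (rule weak_conv_imp_bdd_ae_continuous_conv[OF \<rho>(1) N'(1) weak])
    have "isCont g x" if "x \<noteq> 1/2" for x
    proof (cases "x > 1/2")
      case True
      have "\<forall>\<^sub>F y in nhds x. g y = 1 / y"
        using eventually_nhds_in_open[of "{1/2<..}" x] True by (auto elim!: eventually_mono simp: g_def)
      moreover have "isCont (\<lambda>y. 1 / y) x" using True by (auto intro!: continuous_intros)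
      ultimately show ?thesis by (simp add: isCont_cong)
    next
      case False
      then have "\<forall>\<^sub>F y in nhds x. g y = 0"
        using eventually_nhds_in_open[of "{..<1/2}" x] that by (auto elim!: eventually_mono simp: g_def)
      then show ?thesis using isCont_cong[of g "\<lambda>_. 0" x] by simp
    qed
    then have "{x. \<not> isCont g x} \<subseteq> {1/2}" by blast
    then show "emeasure (generalized_arcsine \<alpha>) {x. \<not> isCont g x} = 0"
      using generalized_arcsine_no_atom[of "1/2" \<alpha>]
        emeasure_mono[of "{x. \<not> isCont g x}" "{1/2}" "generalized_arcsine \<alpha>"]
        real_distribution.events_eq_borel[OF N'(1)] by simp
    show "norm (g x) \<le> 2" for x by (auto simp: g_def field_simps)
  qed measurable
  also have "(\<integral>x. g x \<partial>generalized_arcsine \<alpha>) = 1 / stieltjes_const \<alpha>"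
    unfolding g_def by (rule generalized_arcsine_test[OF a])
  also have "(\<lambda>n. \<integral>x. g x \<partial>\<rho> n) = (\<lambda>n. measure \<sigma> {0..<ennreal (s n)} / k (s n))"
  proof
    fix n
    have "stieltjes_weight (s n) t * g (stieltjes_weight (s n) t) = indicator {0..<ennreal (s n)} t" for t
      using stieltjes_weight_gt_iff[OF s(1)[of n], of "1/2" t] by (auto simp: g_def indicator_def)
    then show "(\<integral>x. g x \<partial>\<rho> n) = measure \<sigma> {0..<ennreal (s n)} / k (s n)"
      using S by (subst int) auto
  qed
  finally have "(\<lambda>n. measure \<sigma> {0..<ennreal (1 / X (n + N))} / k (1 / X (n + N))) \<longlonglongrightarrow> 1 / stieltjes_const \<alpha>"
    by (simp add: s_def)
  then show "(\<lambda>n. measure \<sigma> {0..<ennreal (1 / X n)} / (\<integral>t. stieltjes_weight (1 / X n) t \<partial>\<sigma>)) \<longlonglongrightarrow> 1 / stieltjes_const \<alpha>"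
    unfolding k_def by (rule LIMSEQ_offset)
qed

section \<open>Initial mass and Levy exponent\<close>

lemma asymp_equiv_cmult:
  fixes f g :: "'a \<Rightarrow> real"
  shows "f \<sim>[F] g \<Longrightarrow> (\<lambda>x. c * f x) \<sim>[F] (\<lambda>x. c * g x)"
  by (intro asymp_equiv_mult asymp_equiv_refl)

lemma stieltjes_asymp_iff:
  fixes \<sigma> :: "ennreal measure"
  assumes a: "0 \<le> \<alpha>" "\<alpha> < 1" and L: "slowly_varying L"
    and fin: "finite_measure \<sigma>" and S: "sets \<sigma> = sets borel"
  shows "(\<lambda>x. measure \<sigma> {0..<ennreal (1 / x)}) \<sim>[at_top] (\<lambda>x. x powr (- \<alpha>) * L x) \<longleftrightarrow>
    (\<lambda>x. \<integral>t. stieltjes_weight (1 / x) t \<partial>\<sigma>) \<sim>[at_top] (\<lambda>x. stieltjes_const \<alpha> * x powr (- \<alpha>) * L x)"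
    (is "?F \<sim>[at_top] ?R \<longleftrightarrow> ?K \<sim>[at_top] ?CR")
proof
  let ?C = "stieltjes_const \<alpha>"
  have C: "?C > 0" by (rule stieltjes_const_pos[OF a])
  {
    assume F: "?F \<sim>[at_top] ?R"
    then have "?F \<sim>[at_top] (\<lambda>x. 1 * x powr (- \<alpha>) * L x)" by simp
    from asymp_equivI'_const[OF stieltjes_abelian[OF a L fin S this]]
    have "?K \<sim>[at_top] (\<lambda>x. ?C * ?F x)" using C by simp
    also have "\<dots> \<sim>[at_top] (\<lambda>x. ?C * ?R x)" by (rule asymp_equiv_cmult[OF F])
    finally show "?K \<sim>[at_top] ?CR" by (simp add: mult.assoc)
  }
  assume K: "?K \<sim>[at_top] ?CR"
  from asymp_equivI'_const[OF stieltjes_tauberian[OF a L fin S C K]]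
  have "?F \<sim>[at_top] (\<lambda>x. 1 / ?C * ?K x)" using C by simp
  also have "\<dots> \<sim>[at_top] (\<lambda>x. 1 / ?C * ?CR x)" by (rule asymp_equiv_cmult[OF K])
  finally show "?F \<sim>[at_top] ?R" using C by (simp add: mult.assoc)
qed

text \<open>
  With \<open>s = 1 / x\<close> the kernel is
  \<open>(1 - s t) / (- s - t) = s - (1 + s\<^sup>2) / (s + t)\<close>, also at infinity. So the exponent is minus
  a Stieltjes transform up to a bounded term and a factor that tends to 1.
\<close>

lemma levy_exponent_eq_stieltjes:
  fixes \<sigma> :: "ennreal measure"
  assumes fin: "finite_measure \<sigma>" and S: "sets \<sigma> = sets borel"
    and v: "levy_exponent \<gamma> \<sigma> v" and x: "x > 0"
  shows "v (- 1 / (x + 1)) = \<gamma> + measure \<sigma> (space \<sigma>) / x - (1 + 1 / x\<^sup>2) * (x * (\<integral>t. stieltjes_weight (1 / x) t \<partial>\<sigma>))"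
proof -
  interpret finite_measure \<sigma> by fact
  have [measurable]: "stieltjes_weight (1 / x) \<in> borel_measurable \<sigma>"
    using stieltjes_weight_measurable by (simp add: measurable_cong_sets[OF S refl])
  have int: "integrable \<sigma> (stieltjes_weight (1 / x))"
    by (rule integrable_const_bound[where B = 1]) (use stieltjes_weight_bounds x in auto)
  have kernel: "levy_kernel (- (1 / x)) t = 1 / x - (1 + 1 / x\<^sup>2) * x * stieltjes_weight (1 / x) t" for t
  proof (cases "t = \<infinity>")
    case False
    define r where "r = enn2real t"
    have "1 + x * r > 0" using x by (intro add_pos_nonneg) (auto simp: r_def)
    then have "(1 + r * - (1 / x)) / (- (1 / x) - r) = 1 / x - (1 + 1 / x\<^sup>2) * x * ((1 / x) / (1 / x + r))"
      using x by (simp add: divide_simps) (simp add: power2_eq_square algebra_simps)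
    then show ?thesis using False by (simp add: levy_kernel_def stieltjes_weight_def r_def)
  qed (simp add: levy_kernel_def stieltjes_weight_def)
  have "- (1 / x) / (1 - - (1 / x)) = - 1 / (x + 1)" using x by (simp add: field_simps)
  moreover have "v (- (1 / x) / (1 - - (1 / x))) = \<gamma> + (\<integral>t. levy_kernel (- (1 / x)) t \<partial>\<sigma>)"
    using v x unfolding levy_exponent_def by (elim allE[of _ "- (1 / x)"]) simp
  ultimately have "v (- 1 / (x + 1)) = \<gamma> + (\<integral>t. levy_kernel (- (1 / x)) t \<partial>\<sigma>)" by simp
  also have "(\<integral>t. levy_kernel (- (1 / x)) t \<partial>\<sigma>) =
      measure \<sigma> (space \<sigma>) / x - (1 + 1 / x\<^sup>2) * (x * (\<integral>t. stieltjes_weight (1 / x) t \<partial>\<sigma>))"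
    unfolding kernel using int by (simp add: mult.assoc)
  finally show ?thesis by simp
qed

lemma asymp_equiv_shift_iff:
  fixes f g :: "real \<Rightarrow> real"
  shows "f \<sim>[at_top] g \<longleftrightarrow> (\<lambda>x. f (x + c)) \<sim>[at_top] (\<lambda>x. g (x + c))"
proof
  have sh: "filterlim (\<lambda>x::real. x + d) at_top at_top" for d
    by real_asymp
  show "(\<lambda>x. f (x + c)) \<sim>[at_top] (\<lambda>x. g (x + c))" if "f \<sim>[at_top] g"
    by (rule asymp_equiv_compose'[OF that sh])
  show "f \<sim>[at_top] g" if "(\<lambda>x. f (x + c)) \<sim>[at_top] (\<lambda>x. g (x + c))"
    using asymp_equiv_compose'[OF that sh[of "- c"]] by simp
qed

text \<open>
  The bounded part of the exponent is negligible because \<open>x powr (1 - \<alpha>) * L x\<close> diverges, and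
  the shift of the argument by 1 is harmless by uniform convergence.
\<close>

lemma levy_exponent_asymp_iff:
  fixes \<sigma> :: "ennreal measure"
  assumes a: "0 \<le> \<alpha>" "\<alpha> < 1" and L: "slowly_varying L"
    and fin: "finite_measure \<sigma>" and S: "sets \<sigma> = sets borel"
    and v: "levy_exponent \<gamma> \<sigma> v"
  shows "(\<lambda>x. v (- 1 / x)) \<sim>[at_top] (\<lambda>x. - stieltjes_const \<alpha> * x powr (1 - \<alpha>) * L x) \<longleftrightarrow>
    (\<lambda>x. \<integral>t. stieltjes_weight (1 / x) t \<partial>\<sigma>) \<sim>[at_top] (\<lambda>x. stieltjes_const \<alpha> * x powr (- \<alpha>) * L x)"
proof -
  define C where "C = stieltjes_const \<alpha>"
  have C: "C > 0" unfolding C_def by (rule stieltjes_const_pos[OF a])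
  define H where "H = (\<lambda>x. x powr (1 - \<alpha>) * L x)"
  define K where "K = (\<lambda>x. \<integral>t. stieltjes_weight (1 / x) t \<partial>\<sigma>)"
  define m where "m = measure \<sigma> (space \<sigma>)"
  define A where "A = (\<lambda>x::real. \<gamma> + m / x)"
  have H: "filterlim H at_top at_top"
    unfolding H_def by (rule slowly_varying_powr_mult_at_top[OF L]) (use a in simp)
  have sh: "filterlim (\<lambda>x::real. x + 1) at_top at_top"
    by real_asymp
  have x1: "(\<lambda>x::real. x + 1) \<sim>[at_top] (\<lambda>x. x)"
    by (rule asymp_equivI') real_asymp
  have H1: "(\<lambda>x. H (x + 1)) \<sim>[at_top] H"
    unfolding H_def
    by (intro asymp_equiv_mult asymp_equiv_powr_real slowly_varying_compose_equiv[OF L sh x1] x1)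
      (auto intro: eventually_mono[OF eventually_ge_at_top[of 0]])
  have CH: "filterlim (\<lambda>x. - C * H x) at_bot at_top"
    using filterlim_tendsto_neg_mult_at_bot[OF tendsto_const _ H, of "- C"] C by simp
  have A: "A \<in> o[at_top](\<lambda>x. - C * H x)"
  proof (rule smalloI_tendsto)
    have "(A \<longlongrightarrow> \<gamma> + 0) at_top" unfolding A_def by (intro tendsto_intros) real_asymp
    then show "((\<lambda>x. A x / (- C * H x)) \<longlongrightarrow> 0) at_top"
      by (rule tendsto_divide_0) (rule filterlim_at_bot_imp_at_infinity[OF CH])
    show "\<forall>\<^sub>F x in at_top. - C * H x \<noteq> 0"
      using filterlim_at_bot_dense[THEN iffD1, OF CH, rule_format, of 0] by eventually_elim auto
  qed
  have "(\<lambda>x. v (- 1 / x)) \<sim>[at_top] (\<lambda>x. - C * x powr (1 - \<alpha>) * L x) \<longleftrightarrow>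
      (\<lambda>x. v (- 1 / x)) \<sim>[at_top] (\<lambda>x. - C * H x)"
    by (simp add: H_def mult.assoc)
  also have "\<dots> \<longleftrightarrow> (\<lambda>x. v (- 1 / (x + 1))) \<sim>[at_top] (\<lambda>x. - C * H (x + 1))"
    by (rule asymp_equiv_shift_iff)
  also have "\<dots> \<longleftrightarrow> (\<lambda>x. v (- 1 / (x + 1))) \<sim>[at_top] (\<lambda>x. - C * H x)"
    using asymp_equiv_cmult[OF H1, of "- C"] asymp_equiv_trans asymp_equiv_symI by blast
  also have "\<dots> \<longleftrightarrow> (\<lambda>x. A x + - ((1 + 1 / x\<^sup>2) * (x * K x))) \<sim>[at_top] (\<lambda>x. - C * H x)"
  proof (rule asymp_equiv_cong)
    show "\<forall>\<^sub>F x in at_top. v (- 1 / (x + 1)) = A x + - ((1 + 1 / x\<^sup>2) * (x * K x))"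
      using eventually_gt_at_top[of 0]
      by eventually_elim (use levy_exponent_eq_stieltjes[OF fin S v] in \<open>simp add: A_def K_def m_def\<close>)
  qed simp
  also have "\<dots> \<longleftrightarrow> (\<lambda>x. - ((1 + 1 / x\<^sup>2) * (x * K x))) \<sim>[at_top] (\<lambda>x. - (C * H x))"
    unfolding mult_minus_left[symmetric] by (rule asymp_equiv_add_left[OF A])
  also have "\<dots> \<longleftrightarrow> (\<lambda>x. (1 + 1 / x\<^sup>2) * (x * K x)) \<sim>[at_top] (\<lambda>x. C * H x)"
    by (simp only: asymp_equiv_uminus_iff minus_minus)
  also have "\<dots> \<longleftrightarrow> (\<lambda>x. x * K x) \<sim>[at_top] (\<lambda>x. C * H x)"
  proof -
    have "(\<lambda>x::real. 1 + 1 / x\<^sup>2) \<sim>[at_top] (\<lambda>x. 1)" by (rule asymp_equivI') real_asymp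
    from asymp_equiv_mult[OF this asymp_equiv_refl, of "\<lambda>x. x * K x"]
    have "(\<lambda>x. (1 + 1 / x\<^sup>2) * (x * K x)) \<sim>[at_top] (\<lambda>x. x * K x)" by simp
    then show ?thesis using asymp_equiv_trans asymp_equiv_symI by blast
  qed
  also have "\<dots> \<longleftrightarrow> K \<sim>[at_top] (\<lambda>x. C * x powr (- \<alpha>) * L x)"
  proof
    assume *: "(\<lambda>x. x * K x) \<sim>[at_top] (\<lambda>x. C * H x)"
    have "(\<lambda>x. x * K x / x) \<sim>[at_top] (\<lambda>x. C * H x / x)" by (rule asymp_equiv_divide[OF * asymp_equiv_refl])
    then show "K \<sim>[at_top] (\<lambda>x. C * x powr (- \<alpha>) * L x)"
    proof (rule asymp_equiv_transfer)
      show "\<forall>\<^sub>F x in at_top. x * K x / x = K x"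
        using eventually_gt_at_top[of 0] by eventually_elim simp
      show "\<forall>\<^sub>F x in at_top. C * H x / x = C * x powr (- \<alpha>) * L x"
        using eventually_gt_at_top[of 0] by eventually_elim (simp add: H_def powr_diff powr_minus field_simps)
    qed
  next
    assume *: "K \<sim>[at_top] (\<lambda>x. C * x powr (- \<alpha>) * L x)"
    have "(\<lambda>x. x * K x) \<sim>[at_top] (\<lambda>x. x * (C * x powr (- \<alpha>) * L x))" by (rule asymp_equiv_mult[OF asymp_equiv_refl *])
    then show "(\<lambda>x. x * K x) \<sim>[at_top] (\<lambda>x. C * H x)"
    proof (rule asymp_equiv_transfer)
      show "\<forall>\<^sub>F x in at_top. x * (C * x powr (- \<alpha>) * L x) = C * H x"
        using eventually_gt_at_top[of 0] by eventually_elim (simp add: H_def powr_diff powr_minus field_simps)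
    qed simp
  qed
  finally show ?thesis unfolding C_def K_def .
qed

lemma initial_mass_at_right_iff:
  fixes \<sigma> :: "ennreal measure"
  shows "(\<lambda>x. measure \<sigma> {0..<ennreal x}) \<sim>[at_right 0] (\<lambda>x. x powr \<alpha> * L (1 / x)) \<longleftrightarrow>
    (\<lambda>x. measure \<sigma> {0..<ennreal (1 / x)}) \<sim>[at_top] (\<lambda>x. x powr (- \<alpha>) * L x)"
  unfolding at_right_to_top asymp_equiv_filtermap_iff
proof (rule asymp_equiv_cong)
  show "\<forall>\<^sub>F x in at_top. inverse x powr \<alpha> * L (1 / inverse x) = x powr (- \<alpha>) * L x"
    using eventually_gt_at_top[of 0]
    by eventually_elim (simp add: powr_minus inverse_powr divide_inverse)
qed (simp add: divide_inverse)

theorem initial_mass_iff_levy_exponent: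
  fixes \<sigma> :: "ennreal measure"
  assumes a: "0 \<le> \<alpha>" "\<alpha> < 1" and L: "slowly_varying L"
    and fin: "finite_measure \<sigma>" and S: "sets \<sigma> = sets borel"
    and v: "levy_exponent \<gamma> \<sigma> v"
  shows "(\<lambda>x. measure \<sigma> {0..<ennreal x}) \<sim>[at_right 0] (\<lambda>x. x powr \<alpha> * L (1 / x)) \<longleftrightarrow>
    (\<lambda>x. v (- 1 / x)) \<sim>[at_top] (\<lambda>x. - stieltjes_const \<alpha> * x powr (1 - \<alpha>) * L x)"
  unfolding initial_mass_at_right_iff stieltjes_asymp_iff[OF a L fin S] levy_exponent_asymp_iff[OF assms] ..

section \<open>The tail transform of a law on the positive half-line\<close>

text \<open>
  Minus the value of \<open>psi \<mu>\<close> at \<open>- 1 / y\<close>, for laws that charge only the positive half-line.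
\<close>

definition tail_transform :: "real measure \<Rightarrow> real \<Rightarrow> real" where
  "tail_transform \<mu> y = (\<integral>t. t / (y + t) \<partial>\<mu>)"

context
  fixes \<mu> :: "real measure"
  assumes prob: "prob_space \<mu>" and sets: "sets \<mu> = sets borel" and pos: "AE t in \<mu>. 0 < t"
begin

interpretation prob_space \<mu> by (rule prob)

lemma borel_measurable_law [measurable]: "f \<in> borel_measurable borel \<Longrightarrow> f \<in> borel_measurable \<mu>" for f :: "real \<Rightarrow> real"
  by (simp add: measurable_cong_sets[OF sets refl])

lemma tail_transform_integrable: "0 \<le> y \<Longrightarrow> integrable \<mu> (\<lambda>t. t / (y + t))"
proof (rule integrable_const_bound[where B = 1])
  show "AE t in \<mu>. norm (t / (y + t)) \<le> 1" if "0 \<le> y"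
    using pos by eventually_elim (use that in \<open>simp add: abs_le_iff\<close>)
qed measurable

lemma tail_transform_bounds:
  assumes "y > 0" shows "0 < tail_transform \<mu> y" "tail_transform \<mu> y < 1"
proof -
  have "(\<integral>t. 0 \<partial>\<mu>) < (\<integral>t. t / (y + t) \<partial>\<mu>)"
    by (rule integral_less_AE_space[OF _ tail_transform_integrable])
      (use pos assms emeasure_space_1 in \<open>auto elim!: eventually_mono\<close>)
  then show "0 < tail_transform \<mu> y" by (simp add: tail_transform_def)
  have "(\<integral>t. t / (y + t) \<partial>\<mu>) < (\<integral>t. 1 \<partial>\<mu>)"
    by (rule integral_less_AE_space[OF tail_transform_integrable])
      (use pos assms emeasure_space_1 in \<open>auto elim!: eventually_mono\<close>)
  then show "tail_transform \<mu> y < 1" using prob_space by (simp add: tail_transform_def)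
qed

lemma tail_transform_strict_antimono:
  assumes "0 < y" "y < y'" shows "tail_transform \<mu> y' < tail_transform \<mu> y"
  unfolding tail_transform_def
proof (rule integral_less_AE_space[OF tail_transform_integrable tail_transform_integrable])
  show "AE t in \<mu>. t / (y' + t) < t / (y + t)"
    using pos by eventually_elim (use assms in \<open>auto intro!: divide_strict_left_mono mult_pos_pos\<close>)
qed (use assms emeasure_space_1 in auto)

lemma tail_transform_tendsto_0: "(tail_transform \<mu> \<longlongrightarrow> 0) at_top"
proof -
  have "((\<lambda>y. \<integral>t. t / (y + t) \<partial>\<mu>) \<longlongrightarrow> (\<integral>t. 0 \<partial>\<mu>)) at_top"
  proof (rule integral_dominated_convergence_at_top[where w = "\<lambda>_. 1"])
    show "AE t in \<mu>. ((\<lambda>y. t / (y + t)) \<longlongrightarrow> 0) at_top"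
      by (rule AE_I2) real_asymp
    show "\<forall>\<^sub>F y in at_top. AE t in \<mu>. norm (t / (y + t)) \<le> 1"
      using eventually_gt_at_top[of 0]
    proof eventually_elim
      case (elim y)
      show ?case using pos by eventually_elim (use elim in \<open>simp add: abs_le_iff\<close>)
    qed
  qed auto
  then show ?thesis unfolding tail_transform_def[abs_def] by simp
qed

lemma psi_eq_tail_transform:
  assumes "y > 0" shows "psi \<mu> (- 1 / y) = - tail_transform \<mu> y"
proof -
  have "psi \<mu> (- 1 / y) = (\<integral>t. - (t / (y + t)) \<partial>\<mu>)"
    unfolding psi_def set_lebesgue_integral_def
  proof (rule integral_cong_AE)
    show "AE t in \<mu>. indicator {0..} t *\<^sub>R (- 1 / y * t / (1 - - 1 / y * t)) = - (t / (y + t))"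
      using pos by eventually_elim (use assms in \<open>simp add: field_simps\<close>)
  qed measurable
  then show ?thesis by (simp add: tail_transform_def)
qed

lemma chi_tail_transform:
  assumes "y > 0" shows "chi \<mu> (- tail_transform \<mu> y) = - 1 / y"
proof -
  have "inj_on (psi \<mu>) {..<0}"
  proof (rule linorder_inj_onI)
    fix a b :: real assume ab: "a < b" "a \<in> {..<0}" "b \<in> {..<0}"
    have "tail_transform \<mu> (- 1 / b) < tail_transform \<mu> (- 1 / a)"
      by (rule tail_transform_strict_antimono) (use ab in \<open>auto simp: field_simps\<close>)
    then show "psi \<mu> a \<noteq> psi \<mu> b"
      using psi_eq_tail_transform[of "- 1 / a"] psi_eq_tail_transform[of "- 1 / b"] ab
      by (simp add: divide_neg_neg)
  qed auto
  then have "chi \<mu> (psi \<mu> (- 1 / y)) = - 1 / y"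
    unfolding chi_def by (rule the_inv_into_f_f) (use assms in simp)
  then show ?thesis by (simp only: psi_eq_tail_transform[OF assms])
qed

text \<open>
  On \<open>(y, \<infinity>)\<close> the integrand \<open>t / (z + t)\<close> is at least \<open>y / (z + y)\<close>, hence close to 1 when
  \<open>z\<close> is much smaller than \<open>y\<close>.
\<close>

lemma tail_le_tail_transform:
  assumes "0 < z" "0 < y"
  shows "measure \<mu> {y<..} \<le> (1 + z / y) * tail_transform \<mu> z"
proof -
  have ind: "integrable \<mu> (indicator {y<..} :: real \<Rightarrow> real)"
    by (rule integrable_const_bound[where B = 1]) (use sets in auto)
  have "measure \<mu> {y<..} = (\<integral>t. indicator {y<..} t \<partial>\<mu>)" using sets by simp
  also have "\<dots> \<le> (\<integral>t. (1 + z / y) * (t / (z + t)) \<partial>\<mu>)"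
  proof (rule integral_mono_AE)
    show "AE t in \<mu>. indicator {y<..} t \<le> (1 + z / y) * (t / (z + t))"
      using pos
    proof eventually_elim
      case (elim t)
      show ?case
      proof (cases "t > y")
        case True
        have "z \<le> z / y * t" using True assms by (simp add: field_simps)
        then have "z + t \<le> (1 + z / y) * t" by (simp add: algebra_simps)
        then have "1 \<le> (1 + z / y) * t / (z + t)" using elim assms by (simp add: le_divide_eq)
        then show ?thesis using True by simp
      next
        case False
        then show ?thesis using elim assms by simp
      qed
    qed
    show "integrable \<mu> (indicator {y<..} :: real \<Rightarrow> real)" by (rule ind)
    show "integrable \<mu> (\<lambda>t. (1 + z / y) * (t / (z + t)))"
      by (rule integrable_mult_right) (use tail_transform_integrable[of z] assms in simp)
  qed
  also have "\<dots> = (1 + z / y) * tail_transform \<mu> z"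
    unfolding tail_transform_def by (rule integral_mult_right_zero)
  finally show ?thesis .
qed

text \<open>
  Below \<open>y\<close> the integrand \<open>t / (z + t)\<close> is at most \<open>y / z\<close>, hence negligible when \<open>z\<close> is much
  larger than \<open>y\<close>.
\<close>

lemma tail_transform_le_tail:
  assumes "0 < z" "0 < y"
  shows "tail_transform \<mu> z \<le> measure \<mu> {y<..} + y / z"
proof -
  have ind: "integrable \<mu> (indicator {y<..} :: real \<Rightarrow> real)"
    by (rule integrable_const_bound[where B = 1]) (use sets in auto)
  have "tail_transform \<mu> z \<le> (\<integral>t. indicator {y<..} t + y / z \<partial>\<mu>)"
    unfolding tail_transform_def
  proof (rule integral_mono_AE)
    show "AE t in \<mu>. t / (z + t) \<le> indicator {y<..} t + y / z"
      using pos
    proof eventually_elim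
      case (elim t)
      show ?case
      proof (cases "t > y")
        case True
        have "t / (z + t) \<le> 1" using elim assms by simp
        also have "1 \<le> 1 + y / z" using assms by simp
        finally show ?thesis using True by simp
      next
        case False
        then have "t / (z + t) \<le> y / z" using elim assms by (intro frac_le) auto
        then show ?thesis using False by simp
      qed
    qed
    show "integrable \<mu> (\<lambda>t. indicator {y<..} t + y / z)"
      by (rule Bochner_Integration.integrable_add[OF ind]) simp
  qed (use tail_transform_integrable[of z] assms in simp)
  also have "\<dots> = measure \<mu> {y<..} + y / z"
    using sets prob_space by (subst Bochner_Integration.integral_add[OF ind]) auto
  finally show ?thesis .
qed

end

text \<open>
  The domain of the S-transform is the whole interval \<open>(-1, 0)\<close> only if there is no atom at 0.
\<close>

lemma free_mult_id_law_positive: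
  assumes "free_mult_id_law \<gamma> \<sigma> \<mu>"
  shows "prob_space \<mu>" "sets \<mu> = sets borel" "AE t in \<mu>. 0 < t"
proof -
  show P: "prob_space \<mu>" and S: "sets \<mu> = sets borel"
    using assms by (auto simp: free_mult_id_law_def prob_on_nonneg_def)
  interpret prob_space \<mu> by (rule P)
  have "{measure \<mu> {0} - 1<..<0} = {-1<..<(0::real)}"
    using assms by (simp add: free_mult_id_law_def S_domain_def)
  \<comment> \<open>the midpoint of \<open>-1\<close> and \<open>measure \<mu> {0} - 1\<close> separates the two intervals unless they agree\<close>
  moreover have "(measure \<mu> {0} - 2) / 2 \<notin> {measure \<mu> {0} - 1<..<0}" by (simp add: not_less)
  ultimately have "(measure \<mu> {0} - 2) / 2 \<notin> {-1<..<0}" by simp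
  moreover have "0 \<le> measure \<mu> {0}" "measure \<mu> {0} \<le> 1" by simp_all
  ultimately have "measure \<mu> {0} = 0" by (simp add: field_simps)
  then have "emeasure \<mu> {0} = 0" by (simp add: emeasure_eq_measure)
  moreover have "emeasure \<mu> {..<0} = 0" using assms by (simp add: free_mult_id_law_def prob_on_nonneg_def)
  ultimately have "{..<0} \<union> {0} \<in> null_sets \<mu>" using S by (intro null_sets.Un) auto
  then show "AE t in \<mu>. 0 < t"
    by (rule AE_I') auto
qed

text \<open>
  Put \<open>u = tail_transform \<mu> y\<close>. Since \<open>psi \<mu> (- 1 / y) = - u\<close>, the inverse function satisfies
  \<open>chi \<mu> (- u) = - 1 / y\<close>. Inserting this into the S-transform at \<open>- u\<close> and solving for
  \<open>y\<close> gives an explicit inverse of the tail transform. It is written in terms of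
  \<open>x = 1 / u\<close>, the variable in which the exponent is described.
\<close>

lemma free_mult_id_law_parametrization:
  assumes law: "free_mult_id_law \<gamma> \<sigma> \<mu>"
  shows "\<exists>v. levy_exponent \<gamma> \<sigma> v \<and>
    (\<forall>y>0. y = (1 / tail_transform \<mu> y - 1) * exp (- v (- 1 / (1 / tail_transform \<mu> y))))"
proof -
  note T = free_mult_id_law_positive[OF law]
  obtain v where v: "levy_exponent \<gamma> \<sigma> v" "\<And>z. z \<in> {-1<..<0} \<Longrightarrow> S_transform \<mu> z = exp (v z)"
    using law unfolding free_mult_id_law_def by blast
  show ?thesis
  proof (intro exI conjI allI impI)
    show "levy_exponent \<gamma> \<sigma> v" by (rule v(1))
    fix y :: real assume y: "y > 0"
    define u where "u = tail_transform \<mu> y"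
    have u: "0 < u" "u < 1" using tail_transform_bounds[OF T y] by (auto simp: u_def)
    have "exp (v (- u)) = S_transform \<mu> (- u)" using v(2)[of "- u"] u by simp
    also have "\<dots> = (- u + 1) / (- u) * (- 1 / y)"
      unfolding S_transform_def using chi_tail_transform[OF T y] by (simp add: u_def)
    also have "\<dots> = (1 / u - 1) / y" using u y by (simp add: field_simps)
    finally have "(1 / u - 1) = y * exp (v (- u))" using y by (simp add: field_simps)
    then have "(1 / u - 1) * exp (- v (- u)) = y" by (simp add: exp_minus)
    then show "y = (1 / tail_transform \<mu> y - 1) * exp (- v (- 1 / (1 / tail_transform \<mu> y)))"
      by (simp add: u_def)
  qed
qed

section \<open>Asymptotics of the tail\<close>

lemma slowly_varying_cmult_equiv:
  assumes L: "slowly_varying L" and c: "c > 0" and g: "filterlim g at_top F"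
  shows "(\<lambda>x. L (c * g x)) \<sim>[F] (\<lambda>x. L (g x))"
proof -
  have "(\<lambda>x. L (c * x)) \<sim>[at_top] L" by (rule asymp_equivI') (rule slowly_varying_scale[OF L c])
  then show ?thesis by (rule asymp_equiv_compose'[OF _ g])
qed

text \<open>
  Taking logarithms in \<open>y = (x - 1) * exp (- v (- 1 / x))\<close> with \<open>x = 1 / tail_transform \<mu> y\<close>, the
  term \<open>ln (x - 1)\<close> is negligible against the regularly varying exponent, whose index is
  positive.
\<close>

lemma ln_tail_transform_asymp:
  assumes law: "free_mult_id_law \<gamma> \<sigma> \<mu>" and p: "p > 0" and C: "C > 0" and L: "slowly_varying L"
    and v_asymp: "\<And>v. levy_exponent \<gamma> \<sigma> v \<Longrightarrow> (\<lambda>x. v (- 1 / x)) \<sim>[at_top] (\<lambda>x. - C * x powr p * L x)"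
  shows "filterlim (\<lambda>y. 1 / tail_transform \<mu> y) at_top at_top"
    and "ln \<sim>[at_top] (\<lambda>y. C * (1 / tail_transform \<mu> y) powr p * L (1 / tail_transform \<mu> y))"
proof -
  note T = free_mult_id_law_positive[OF law]
  note U = tail_transform_bounds[OF T]
  obtain v where v: "levy_exponent \<gamma> \<sigma> v"
    "\<And>y. y > 0 \<Longrightarrow> y = (1 / tail_transform \<mu> y - 1) * exp (- v (- 1 / (1 / tail_transform \<mu> y)))"
    using free_mult_id_law_parametrization[OF law] by blast
  define X where "X = (\<lambda>y. 1 / tail_transform \<mu> y)"
  have "filterlim (\<lambda>y. inverse (tail_transform \<mu> y)) at_top at_top"
    by (rule filterlim_inverse_at_top[OF tail_transform_tendsto_0[OF T]])
      (use U in \<open>auto intro: eventually_mono[OF eventually_gt_at_top[of 0]]\<close>)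
  then show X: "filterlim (\<lambda>y. 1 / tail_transform \<mu> y) at_top at_top" by (simp add: divide_inverse)
  define H where "H = (\<lambda>x. x powr p * L x)"
  have H2: "filterlim (\<lambda>x. x powr (p / 2) * L x) at_top at_top"
    by (rule slowly_varying_powr_mult_at_top[OF L]) (use p in simp)
  have nv: "(\<lambda>x. - v (- 1 / x)) \<sim>[at_top] (\<lambda>x. C * H x)"
    using asymp_equiv_uminus[OF v_asymp[OF v(1)]] by (simp add: H_def mult.assoc)
  have small: "(\<lambda>x. ln (x - 1)) \<in> o[at_top](\<lambda>x. C * H x)"
  proof (rule smalloI_tendsto)
    have "((\<lambda>x::real. ln (x - 1) / x powr (p / 2)) \<longlongrightarrow> 0) at_top" using p by real_asymp
    moreover have "((\<lambda>x. 1 / C / (x powr (p / 2) * L x)) \<longlongrightarrow> 0) at_top"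
      by (rule tendsto_divide_0[OF tendsto_const filterlim_at_top_imp_at_infinity[OF H2]])
    ultimately have "((\<lambda>x. ln (x - 1) / x powr (p / 2) * (1 / C / (x powr (p / 2) * L x))) \<longlongrightarrow> 0 * 0) at_top"
      by (rule tendsto_mult)
    also have "(\<lambda>x. ln (x - 1) / x powr (p / 2) * (1 / C / (x powr (p / 2) * L x))) = (\<lambda>x. ln (x - 1) / (C * H x))"
    proof
      fix x :: real
      have "x powr p = x powr (p / 2) * x powr (p / 2)" by (simp flip: powr_add)
      then show "ln (x - 1) / x powr (p / 2) * (1 / C / (x powr (p / 2) * L x)) = ln (x - 1) / (C * H x)"
        by (simp add: H_def mult_ac)
    qed
    finally show "((\<lambda>x. ln (x - 1) / (C * H x)) \<longlongrightarrow> 0) at_top" by simp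
    show "\<forall>\<^sub>F x in at_top. C * H x \<noteq> 0"
      using slowly_varying_eventually_pos[OF L] eventually_gt_at_top[of 0]
      by eventually_elim (use C in \<open>simp add: H_def\<close>)
  qed
  have "(\<lambda>x. ln (x - 1) + - v (- 1 / x)) \<sim>[at_top] (\<lambda>x. C * H x)"
    by (rule asymp_equiv_add_left[OF small, THEN iffD2]) (rule nv)
  then have "(\<lambda>y. ln (X y - 1) + - v (- 1 / X y)) \<sim>[at_top] (\<lambda>y. C * H (X y))"
    by (rule asymp_equiv_compose'[OF _ X[folded X_def]])
  then have "ln \<sim>[at_top] (\<lambda>y. C * H (X y))"
  proof (rule asymp_equiv_transfer)
    show "\<forall>\<^sub>F y in at_top. ln (X y - 1) + - v (- 1 / X y) = ln y"
      using eventually_gt_at_top[of 0]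
    proof eventually_elim
      case (elim y)
      have "(X y - 1) * exp (- v (- 1 / X y)) = y"
        unfolding X_def by (rule v(2)[OF elim, symmetric])
      moreover have "X y - 1 > 0" using U[OF elim] by (simp add: X_def)
      then have "ln ((X y - 1) * exp (- v (- 1 / X y))) = ln (X y - 1) + - v (- 1 / X y)"
        by (simp add: ln_mult)
      ultimately show ?case by simp
    qed
  qed simp
  then show "ln \<sim>[at_top] (\<lambda>y. C * (1 / tail_transform \<mu> y) powr p * L (1 / tail_transform \<mu> y))"
    by (simp add: H_def X_def mult.assoc)
qed

text \<open>
  Write \<open>l = L powr (1 / p)\<close>, \<open>w = X y * l (X y)\<close> and \<open>u = ln y powr (1 / p)\<close>. The hypothesis says
  that \<open>C powr (1 / p) * w\<close> is equivalent to \<open>u\<close>, and the conjugate satisfies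
  \<open>l (X y) * L' w \<longlonglongrightarrow> 1\<close>, so \<open>1 / X y = l (X y) / w\<close> is equivalent to \<open>1 / (w * L' w)\<close>. By uniform
  convergence \<open>w\<close> may be replaced inside \<open>L'\<close> by \<open>u\<close>.
\<close>

lemma inverse_asymp_de_Bruijn:
  fixes X :: "real \<Rightarrow> real"
  assumes p: "p > 0" and C: "C > 0" and L: "slowly_varying L"
    and L': "de_Bruijn_conjugate (\<lambda>x. L x powr (1 / p)) L'"
    and X: "filterlim X at_top at_top" and eq: "ln \<sim>[at_top] (\<lambda>y. C * X y powr p * L (X y))"
  shows "(\<lambda>y. 1 / X y) \<sim>[at_top] (\<lambda>y. C powr (1 / p) * (1 / (ln y powr (1 / p) * L' (ln y powr (1 / p)))))"
proof -
  define l where "l = (\<lambda>x. L x powr (1 / p))"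
  have l: "slowly_varying l" unfolding l_def by (rule slowly_varying_powr[OF L])
  have L's: "slowly_varying L'" and conj: "((\<lambda>x. l x * L' (x * l x)) \<longlongrightarrow> 1) at_top"
    using L' by (auto simp: de_Bruijn_conjugate_def l_def)
  define W where "W = (\<lambda>y. X y * l (X y))"
  define u where "u = (\<lambda>y::real. ln y powr (1 / p))"
  have Xpos: "\<forall>\<^sub>F y in at_top. X y > 0" using X by (auto simp: filterlim_at_top_dense)
  have Lpos: "\<forall>\<^sub>F y in at_top. L (X y) > 0"
    by (rule eventually_compose_filterlim[OF slowly_varying_eventually_pos[OF L] X])
  have "filterlim (\<lambda>x. x powr 1 * l x) at_top at_top" by (rule slowly_varying_powr_mult_at_top[OF l]) simp
  from filterlim_compose[OF this X] have "filterlim (\<lambda>y. X y powr 1 * l (X y)) at_top at_top" .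
  then have W: "filterlim W at_top at_top"
    unfolding W_def
    by (rule filterlim_at_top_mono) (use Xpos in eventually_elim, simp)
  have u: "filterlim u at_top at_top" unfolding u_def using p by real_asymp
  have "(\<lambda>y. (C * X y powr p * L (X y)) powr (1 / p)) \<sim>[at_top] (\<lambda>y. ln y powr (1 / p))"
  proof (rule asymp_equiv_powr_real[OF asymp_equiv_symI[OF eq]])
    show "\<forall>\<^sub>F y in at_top. 0 \<le> C * X y powr p * L (X y)"
      using Lpos by eventually_elim (use C in simp)
    show "\<forall>\<^sub>F y::real in at_top. 0 \<le> ln y"
      using eventually_ge_at_top[of 1] by eventually_elim simp
  qed
  then have CW: "(\<lambda>y. C powr (1 / p) * W y) \<sim>[at_top] u"
  proof (rule asymp_equiv_transfer)
    show "\<forall>\<^sub>F y in at_top. (C * X y powr p * L (X y)) powr (1 / p) = C powr (1 / p) * W y"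
      using Xpos Lpos by eventually_elim (use C p in \<open>simp add: W_def l_def powr_mult powr_powr\<close>)
  qed (simp add: u_def)
  have CWtop: "filterlim (\<lambda>y. C powr (1 / p) * W y) at_top at_top"
    by (rule filterlim_tendsto_pos_mult_at_top[OF tendsto_const _ W]) (use C in simp)
  have "(\<lambda>y. L' (W y)) \<sim>[at_top] (\<lambda>y. L' (C powr (1 / p) * W y))"
    by (rule asymp_equiv_symI[OF slowly_varying_cmult_equiv[OF L's _ W]]) (use C in simp)
  also have "\<dots> \<sim>[at_top] (\<lambda>y. L' (u y))"
    by (rule slowly_varying_compose_equiv[OF L's CWtop CW])
  finally have L'W: "(\<lambda>y. L' (W y)) \<sim>[at_top] (\<lambda>y. L' (u y))" .
  have "((\<lambda>y. l (X y) * L' (X y * l (X y))) \<longlongrightarrow> 1) at_top"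
    by (rule filterlim_compose[OF conj X])
  then have "(\<lambda>y. l (X y) * L' (W y)) \<sim>[at_top] (\<lambda>y. 1)"
    by (intro asymp_equivI') (simp add: W_def)
  then have "(\<lambda>y. C powr (1 / p) * (l (X y) * L' (W y)) / (C powr (1 / p) * W y * L' (W y))) \<sim>[at_top]
      (\<lambda>y. C powr (1 / p) * 1 / (u y * L' (u y)))"
    by (intro asymp_equiv_divide asymp_equiv_mult asymp_equiv_refl CW L'W)
  then have "(\<lambda>y. 1 / X y) \<sim>[at_top] (\<lambda>y. C powr (1 / p) * 1 / (u y * L' (u y)))"
  proof (rule asymp_equiv_transfer)
    have "\<forall>\<^sub>F y in at_top. L' (W y) > 0"
      by (rule eventually_compose_filterlim[OF slowly_varying_eventually_pos[OF L's] W])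
    with Xpos Lpos show "\<forall>\<^sub>F y in at_top. C powr (1 / p) * (l (X y) * L' (W y)) / (C powr (1 / p) * W y * L' (W y)) = 1 / X y"
      by eventually_elim (use C in \<open>simp add: W_def l_def\<close>)
  qed simp
  then show ?thesis by (simp add: u_def)
qed

text \<open>
  A function that is regularly varying in \<open>ln y\<close> changes only by a constant factor, close to 1
  when \<open>e\<close> is, if \<open>y\<close> is replaced by \<open>y powr e\<close>.
\<close>

lemma log_regularly_varying_ratio:
  fixes U :: "real \<Rightarrow> real"
  assumes q: "q > 0" and c: "c > 0" and L': "slowly_varying L'" and e: "e > 0"
    and U: "U \<sim>[at_top] (\<lambda>y. c * (1 / (ln y powr q * L' (ln y powr q))))"
  shows "((\<lambda>y. U (y powr e) / U y) \<longlongrightarrow> e powr (- q)) at_top"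
proof -
  define P where "P = (\<lambda>y::real. c * (1 / (ln y powr q * L' (ln y powr q))))"
  have pw: "filterlim (\<lambda>y::real. y powr e) at_top at_top" using e by real_asymp
  have u: "filterlim (\<lambda>y::real. ln y powr q) at_top at_top" using q by real_asymp
  have "(\<lambda>y. U (y powr e)) \<sim>[at_top] (\<lambda>y. P (y powr e))"
    unfolding P_def by (rule asymp_equiv_compose'[OF U pw])
  also have "(\<lambda>y. P (y powr e)) \<sim>[at_top] (\<lambda>y. e powr (- q) * P y)"
  proof -
    have "(\<lambda>y. L' (e powr q * ln y powr q)) \<sim>[at_top] (\<lambda>y. L' (ln y powr q))"
      by (rule slowly_varying_cmult_equiv[OF L' _ u]) (use e in simp)
    then have "(\<lambda>y. c * e powr (- q) * (1 / (ln y powr q * L' (e powr q * ln y powr q)))) \<sim>[at_top]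
        (\<lambda>y. c * e powr (- q) * (1 / (ln y powr q * L' (ln y powr q))))"
      by (intro asymp_equiv_divide asymp_equiv_mult asymp_equiv_refl)
    then show ?thesis
    proof (rule asymp_equiv_transfer)
      show "\<forall>\<^sub>F y in at_top. c * e powr (- q) * (1 / (ln y powr q * L' (e powr q * ln y powr q))) = P (y powr e)"
        using eventually_gt_at_top[of 1]
        by eventually_elim (use e in \<open>simp add: P_def ln_powr powr_mult powr_minus field_simps\<close>)
    qed (simp add: P_def mult_ac)
  qed
  finally have "(\<lambda>y. U (y powr e)) \<sim>[at_top] (\<lambda>y. e powr (- q) * P y)" .
  also have "(\<lambda>y. e powr (- q) * P y) \<sim>[at_top] (\<lambda>y. e powr (- q) * U y)"
    by (rule asymp_equiv_cmult[OF asymp_equiv_symI]) (use U in \<open>simp add: P_def\<close>)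
  finally have *: "(\<lambda>y. U (y powr e)) \<sim>[at_top] (\<lambda>y. e powr (- q) * U y)" .
  have "\<forall>\<^sub>F y in at_top. L' (ln y powr q) > 0"
    by (rule eventually_compose_filterlim[OF slowly_varying_eventually_pos[OF L'] u])
  then have Upos: "\<forall>\<^sub>F y in at_top. U y \<noteq> 0"
    using asymp_equiv_eventually_zeros[OF U] eventually_gt_at_top[of 1]
    by eventually_elim (use c in auto)
  have "((\<lambda>y. U (y powr e) / (e powr (- q) * U y)) \<longlongrightarrow> 1) at_top"
  proof (rule asymp_equivD_strong[OF *])
    show "\<forall>\<^sub>F y in at_top. U (y powr e) \<noteq> 0 \<or> e powr (- q) * U y \<noteq> 0"
      using Upos by eventually_elim (use e in simp)
  qed
  from tendsto_mult[OF tendsto_const[of "e powr (- q)"] this] show ?thesis using e by simp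
qed

text \<open>
  Half of the power suffices to absorb \<open>L\<close>: eventually \<open>X y powr (p / 2) \<le> ln y\<close>, so
  \<open>X\<close> grows at most like a power of the logarithm.
\<close>

lemma neg_powr_mult_tendsto_0:
  fixes X :: "real \<Rightarrow> real"
  assumes p: "p > 0" and C: "C > 0" and L: "slowly_varying L" and e: "e > 0"
    and X: "filterlim X at_top at_top" and eq: "ln \<sim>[at_top] (\<lambda>y. C * X y powr p * L (X y))"
  shows "((\<lambda>y. y powr (- e) * X y) \<longlongrightarrow> 0) at_top"
proof -
  have "filterlim (\<lambda>x. x powr (p / 2) * L x) at_top at_top"
    by (rule slowly_varying_powr_mult_at_top[OF L]) (use p in simp)
  from filterlim_compose[OF this X] have big: "\<forall>\<^sub>F y in at_top. X y powr (p / 2) * L (X y) \<ge> 2 / C"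
    by (auto simp: filterlim_at_top)
  have pos: "\<forall>\<^sub>F y in at_top. X y > 0" using X by (auto simp: filterlim_at_top_dense)
  have Lpos: "\<forall>\<^sub>F y in at_top. L (X y) > 0"
    by (rule eventually_compose_filterlim[OF slowly_varying_eventually_pos[OF L] X])
  have half: "\<forall>\<^sub>F y in at_top. norm (ln y) \<ge> 1/2 * norm (C * X y powr p * L (X y))"
    by (rule asymp_equiv_imp_eventually_ge[OF eq]) simp
  have bound: "\<forall>\<^sub>F y in at_top. norm (y powr (- e) * X y) \<le> y powr (- e) * ln y powr (2 / p)"
    using big pos Lpos half eventually_gt_at_top[of 1]
  proof eventually_elim
    case (elim y)
    have "X y powr (p / 2) * 2 \<le> X y powr (p / 2) * (C * (X y powr (p / 2) * L (X y)))"
      using elim(1) C by (intro mult_left_mono) (auto simp: field_simps)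
    also have "\<dots> = C * X y powr p * L (X y)"
    proof -
      have "X y powr p = X y powr (p / 2) * X y powr (p / 2)" by (simp flip: powr_add)
      then show ?thesis by (simp add: mult_ac)
    qed
    also have "\<dots> \<le> 2 * ln y" using elim C by (simp add: abs_mult)
    finally have "X y powr (p / 2) \<le> ln y" by simp
    then have "(X y powr (p / 2)) powr (2 / p) \<le> ln y powr (2 / p)" using p by (intro powr_mono2) auto
    then have "X y \<le> ln y powr (2 / p)" using p elim by (simp add: powr_powr)
    then show ?case using elim by (simp add: abs_mult mult_left_mono)
  qed
  have "((\<lambda>y::real. y powr (- e) * ln y powr (2 / p)) \<longlongrightarrow> 0) at_top" using e p by real_asymp
  with bound show ?thesis by (rule Lim_null_comparison)
qed

text \<open>
  The tail at \<open>y\<close> lies, up to negligible terms, between the transform at \<open>y powr (1 + e)\<close> and at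
  \<open>y powr (1 - e)\<close>. Both are comparable with the transform at \<open>y\<close>, with constants that tend to
  1 as \<open>e\<close> tends to 0.
\<close>

lemma tail_equiv_tail_transform:
  assumes T: "prob_space \<mu>" "sets \<mu> = sets borel" "AE t in \<mu>. 0 < t"
    and ratio: "\<And>e. e > 0 \<Longrightarrow> ((\<lambda>y. tail_transform \<mu> (y powr e) / tail_transform \<mu> y) \<longlongrightarrow> e powr (- q)) at_top"
    and small: "\<And>e. e > 0 \<Longrightarrow> ((\<lambda>y. y powr (- e) * (1 / tail_transform \<mu> y)) \<longlongrightarrow> 0) at_top"
  shows "(\<lambda>y. measure \<mu> {y<..}) \<sim>[at_top] tail_transform \<mu>"
proof (rule asymp_equivI', rule order_tendstoI)
  let ?U = "tail_transform \<mu>" and ?T = "\<lambda>y. measure \<mu> {y<..}"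
  note U = tail_transform_bounds[OF T]
  have cont: "((\<lambda>e. (1 + e) powr (- q)) \<longlongrightarrow> (1 + 0) powr (- q)) (at_right 0)"
    "((\<lambda>e. (1 - e) powr (- q)) \<longlongrightarrow> (1 - 0) powr (- q)) (at_right 0)"
    by (intro tendsto_intros; simp)+
  have e01: "\<forall>\<^sub>F e in at_right 0. e \<in> {0<..<1::real}" by (rule eventually_at_right_real) simp
  have trivial: "at_right (0::real) \<noteq> bot" by simp
  {
    fix a :: real assume "a < 1"
    then have "\<forall>\<^sub>F e in at_right 0. (1 + e) powr (- q) > a" using order_tendstoD(1)[OF cont(1), of a] by simp
    with e01 have "\<forall>\<^sub>F e in at_right 0. e \<in> {0<..<1} \<and> (1 + e) powr (- q) > a" by eventually_elim simp
    from eventually_happens'[OF trivial this] obtain e where e: "e \<in> {0<..<1}" "(1 + e) powr (- q) > a" by auto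
    have "((\<lambda>y. ?U (y powr (1 + e)) / ?U y - y powr (- e) * (1 / ?U y)) \<longlongrightarrow> (1 + e) powr (- q) - 0) at_top"
      using e by (intro tendsto_diff ratio small) auto
    then have "\<forall>\<^sub>F y in at_top. a < ?U (y powr (1 + e)) / ?U y - y powr (- e) * (1 / ?U y)"
      using e(2) by (intro order_tendstoD(1)) auto
    then show "\<forall>\<^sub>F y in at_top. a < ?T y / ?U y"
      using eventually_gt_at_top[of 0]
    proof eventually_elim
      case (elim y)
      have "?U (y powr (1 + e)) \<le> ?T y + y / y powr (1 + e)"
        by (rule tail_transform_le_tail[OF T]) (use elim in auto)
      also have "y / y powr (1 + e) = y powr (- e)" using elim by (simp add: powr_add powr_minus field_simps)
      finally have "?U (y powr (1 + e)) / ?U y \<le> (?T y + y powr (- e)) / ?U y"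
        using U[OF elim(2)] by (intro divide_right_mono) auto
      then have "?U (y powr (1 + e)) / ?U y - y powr (- e) * (1 / ?U y) \<le> ?T y / ?U y"
        by (simp add: add_divide_distrib)
      with elim show ?case by linarith
    qed
  }
  fix a :: real assume "a > 1"
  then have "\<forall>\<^sub>F e in at_right 0. (1 - e) powr (- q) < a" using order_tendstoD(2)[OF cont(2), of a] by simp
  with e01 have "\<forall>\<^sub>F e in at_right 0. e \<in> {0<..<1} \<and> (1 - e) powr (- q) < a" by eventually_elim simp
  from eventually_happens'[OF trivial this] obtain e where e: "e \<in> {0<..<1}" "(1 - e) powr (- q) < a" by auto
  have "((\<lambda>y::real. 1 + y powr (- e)) \<longlongrightarrow> 1) at_top" using e by real_asymp
  then have "((\<lambda>y. (1 + y powr (- e)) * (?U (y powr (1 - e)) / ?U y)) \<longlongrightarrow> 1 * (1 - e) powr (- q)) at_top"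
    using e by (intro tendsto_mult ratio) auto
  then have "\<forall>\<^sub>F y in at_top. a > (1 + y powr (- e)) * (?U (y powr (1 - e)) / ?U y)"
    using e(2) by (intro order_tendstoD(2)) auto
  then show "\<forall>\<^sub>F y in at_top. ?T y / ?U y < a"
    using eventually_gt_at_top[of 0]
  proof eventually_elim
    case (elim y)
    have "?T y \<le> (1 + y powr (1 - e) / y) * ?U (y powr (1 - e))"
      by (rule tail_le_tail_transform[OF T]) (use elim in auto)
    also have "y powr (1 - e) / y = y powr (- e)" using elim by (simp add: powr_diff powr_minus field_simps)
    finally have "?T y / ?U y \<le> (1 + y powr (- e)) * ?U (y powr (1 - e)) / ?U y"
      using U[OF elim(2)] by (intro divide_right_mono) auto
    with elim show ?case by simp
  qed
qed

theorem theorem6p3: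
  fixes \<alpha> \<gamma> :: real
    and L v :: "real \<Rightarrow> real"
    and \<sigma> :: "ennreal measure"
  assumes "0 \<le> \<alpha>" and "\<alpha> < 1"
    and "slowly_varying L"
    and "finite_measure \<sigma>" and "sets \<sigma> = sets borel"
    and "levy_exponent \<gamma> \<sigma> v"
  shows "let sigma_asymp =
        ((\<lambda>x. measure \<sigma> {0..<ennreal x}) \<sim>[at_right 0] (\<lambda>x. x powr \<alpha> * L (1 / x)));
      v_asymp =
        ((\<lambda>x. v (- 1 / x)) \<sim>[at_top] (\<lambda>x. - stieltjes_const \<alpha> * x powr (1 - \<alpha>) * L x));
      L\<^sub>\<alpha> = (\<lambda>x. L x powr (1 / (1 - \<alpha>)))
    in (sigma_asymp \<longleftrightarrow> v_asymp) \<and>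
      slowly_varying L\<^sub>\<alpha> \<and>
      (sigma_asymp \<or> v_asymp \<longrightarrow>
        (\<forall>\<gamma>' \<mu> L'. free_mult_id_law \<gamma>' \<sigma> \<mu> \<longrightarrow> de_Bruijn_conjugate L\<^sub>\<alpha> L' \<longrightarrow>
          (\<lambda>x. measure \<mu> {x<..}) \<sim>[at_top]
          (\<lambda>x. stieltjes_const \<alpha> powr (1 / (1 - \<alpha>)) *
               (1 / (ln x powr (1 / (1 - \<alpha>)) * L' (ln x powr (1 / (1 - \<alpha>))))))))"
proof -
  note a = assms(1,2) and L = assms(3)
  define C where "C = stieltjes_const \<alpha>"
  have C: "C > 0" unfolding C_def by (rule stieltjes_const_pos[OF a])
  define p where "p = 1 - \<alpha>"
  have p: "p > 0" using a by (simp add: p_def)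
  define sigma_asymp where "sigma_asymp \<longleftrightarrow>
    (\<lambda>x. measure \<sigma> {0..<ennreal x}) \<sim>[at_right 0] (\<lambda>x. x powr \<alpha> * L (1 / x))"
  have iff: "sigma_asymp \<longleftrightarrow> (\<lambda>x. w (- 1 / x)) \<sim>[at_top] (\<lambda>x. - C * x powr p * L x)"
    if "levy_exponent \<gamma>' \<sigma> w" for w \<gamma>'
    unfolding sigma_asymp_def C_def p_def by (rule initial_mass_iff_levy_exponent[OF a L assms(4,5) that])
  have tail: "(\<lambda>x. measure \<mu> {x<..}) \<sim>[at_top]
      (\<lambda>x. C powr (1 / p) * (1 / (ln x powr (1 / p) * L' (ln x powr (1 / p)))))"
    if sigma: sigma_asymp and law: "free_mult_id_law \<gamma>' \<sigma> \<mu>"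
      and L': "de_Bruijn_conjugate (\<lambda>x. L x powr (1 / p)) L'" for \<gamma>' \<mu> L'
  proof -
    note T = free_mult_id_law_positive[OF law]
    have v': "(\<lambda>x. w (- 1 / x)) \<sim>[at_top] (\<lambda>x. - C * x powr p * L x)"
      if "levy_exponent \<gamma>' \<sigma> w" for w using iff[OF that] sigma by blast
    note X = ln_tail_transform_asymp[OF law p C L v']
    have U: "tail_transform \<mu> \<sim>[at_top] (\<lambda>x. C powr (1 / p) * (1 / (ln x powr (1 / p) * L' (ln x powr (1 / p)))))"
      using inverse_asymp_de_Bruijn[OF p C L L' X] by simp
    have "(\<lambda>y. measure \<mu> {y<..}) \<sim>[at_top] tail_transform \<mu>"
    proof (rule tail_equiv_tail_transform[OF T])
      show "((\<lambda>y. tail_transform \<mu> (y powr e) / tail_transform \<mu> y) \<longlongrightarrow> e powr (- (1 / p))) at_top" if "e > 0" for e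
        by (rule log_regularly_varying_ratio[OF _ _ _ that U])
          (use p C L' in \<open>auto simp: de_Bruijn_conjugate_def\<close>)
      show "((\<lambda>y. y powr (- e) * (1 / tail_transform \<mu> y)) \<longlongrightarrow> 0) at_top" if "e > 0" for e
        by (rule neg_powr_mult_tendsto_0[OF p C L that X])
    qed
    from asymp_equiv_trans[OF this U] show ?thesis .
  qed
  show ?thesis
    unfolding Let_def sigma_asymp_def[symmetric] C_def[symmetric] p_def[symmetric]
      iff[OF assms(6), symmetric]
    using tail slowly_varying_powr[OF L] by blast
qed

end
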